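(* Let $\psi$ be a $\mathcal{T}$-formula in d-DNNF which is $\mathcal{T}$-extended with respect to a finite set of atoms $\boldsymbol{\alpha}$ containing its atoms, and let $\gamma$ be a cube on $\boldsymbol{\alpha}$. Then: (a) the $\mathcal{T}$-validity of $\psi$ can be decided in time polynomial in the size of $\psi$; (b) whether $\gamma\models_{\mathcal{T}}\psi$ can be decided in time polynomial in the sizes of $\psi$ and $\gamma$.
   Context: $\mathcal{T}$-formulas are quantifier-free formulas built by Boolean connectives from $\mathcal{T}$-atoms and Boolean atoms, represented as DAGs; size is the number of DAG nodes. The Boolean abstraction maps each atom bijectively to a fresh Boolean variable; $\psi\models_p\chi$ means the abstraction of $\psi$ propositionally entails that of $\chi$. d-DNNF: negation normal form in which the children of every $\wedge$-node share no atoms and the children of every $\vee$-node are pairwise propositionally inconsistent; a $\mathcal{T}$-formula is in d-DNNF iff its Boolean abstraction is. A cube is a conjunction of literals. A total truth assignment on $\boldsymbol{\alpha}$ is a conjunction containing, for each $a\in\boldsymbol{\alpha}$, exactly one of $a,\neg a$. $P_{\boldsymbol{\alpha}}(\chi)$ is the set of $\mathcal{T}$-unsatisfiable total truth assignments $\rho$ on $\boldsymbol{\alpha}$ with $\rho\models_p\chi$; $\psi$ is $\mathcal{T}$-extended with respect to $\boldsymbol{\alpha}$ iff $P_{\boldsymbol{\alpha}}(\neg\psi)=\emptyset$. *)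

theory Defs
  imports "HOL-Computational_Algebra.Polynomial"
begin

section \<open>Quantifier-free formulas and their Boolean abstraction\<close>

text \<open>The constants true and false are the empty conjunction and the empty disjunction.\<close>

datatype (atoms: 'a) fm =
    Atom 'a
  | Neg "'a fm"
  | And "'a fm list"
  | Or "'a fm list"

fun holds :: "('a \<Rightarrow> bool) \<Rightarrow> 'a fm \<Rightarrow> bool" where
  "holds v (Atom a) \<longleftrightarrow> v a"
| "holds v (Neg f) \<longleftrightarrow> \<not> holds v f"
| "holds v (And fs) \<longleftrightarrow> (\<forall>f\<in>set fs. holds v f)"
| "holds v (Or fs) \<longleftrightarrow> (\<exists>f\<in>set fs. holds v f)"

fun subfms :: "'a fm \<Rightarrow> 'a fm set" where
  "subfms (Atom a) = {Atom a}"
| "subfms (Neg f) = insert (Neg f) (subfms f)"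
| "subfms (And fs) = insert (And fs) (\<Union>f\<in>set fs. subfms f)"
| "subfms (Or fs) = insert (Or fs) (\<Union>f\<in>set fs. subfms f)"

datatype 'a bvar = BVar 'a

definition abstraction :: "'a fm \<Rightarrow> 'a bvar fm" where
  "abstraction f = map_fm BVar f"

definition prop_entails :: "'a fm \<Rightarrow> 'a fm \<Rightarrow> bool" where
  "prop_entails f g \<longleftrightarrow> (\<forall>v. holds v f \<longrightarrow> holds v g)"

definition prop_inconsistent :: "'a fm \<Rightarrow> 'a fm \<Rightarrow> bool" where
  "prop_inconsistent f g \<longleftrightarrow> \<not> (\<exists>v. holds v f \<and> holds v g)"

definition entails_p :: "'a fm \<Rightarrow> 'a fm \<Rightarrow> bool" where
  "entails_p f g \<longleftrightarrow> prop_entails (abstraction f) (abstraction g)"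

definition nnf :: "'a fm \<Rightarrow> bool" where
  "nnf f \<longleftrightarrow> (\<forall>g. Neg g \<in> subfms f \<longrightarrow> (\<exists>a. g = Atom a))"

definition decomposable :: "'a fm \<Rightarrow> bool" where
  "decomposable f \<longleftrightarrow> (\<forall>fs. And fs \<in> subfms f \<longrightarrow>
     (\<forall>i j. i < j \<and> j < length fs \<longrightarrow> atoms (fs ! i) \<inter> atoms (fs ! j) = {}))"

definition deterministic :: "'a fm \<Rightarrow> bool" where
  "deterministic f \<longleftrightarrow> (\<forall>fs. Or fs \<in> subfms f \<longrightarrow>
     (\<forall>i j. i < j \<and> j < length fs \<longrightarrow> prop_inconsistent (fs ! i) (fs ! j)))"

definition d_DNNF :: "'a fm \<Rightarrow> bool" where
  "d_DNNF f \<longleftrightarrow> nnf f \<and> decomposable f \<and> deterministic f"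

definition is_literal :: "'a fm \<Rightarrow> bool" where
  "is_literal f \<longleftrightarrow> (\<exists>a. f = Atom a \<or> f = Neg (Atom a))"

definition is_cube :: "'a fm \<Rightarrow> bool" where
  "is_cube f \<longleftrightarrow> is_literal f \<or> (\<exists>ls. f = And ls \<and> (\<forall>l\<in>set ls. is_literal l))"

definition total_assignment :: "'a set \<Rightarrow> 'a fm \<Rightarrow> bool" where
  "total_assignment \<alpha> \<rho> \<longleftrightarrow> (\<exists>ls. \<rho> = And ls \<and> (\<forall>l\<in>set ls. is_literal l) \<and> atoms \<rho> \<subseteq> \<alpha> \<and>
     (\<forall>a\<in>\<alpha>. (Atom a \<in> set ls) \<noteq> (Neg (Atom a) \<in> set ls)))"


section \<open>Theories\<close>

text \<open>Many-sorted first-order logic with equality. A theory is given by its class of models.\<close>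

datatype ('f, 'v) trm = Var 'v | App 'f "('f, 'v) trm list"

datatype ('p, 'f, 'v, 'b) atom =
    BoolAtom 'b
  | PredAtom 'p "('f, 'v) trm list"
  | EqAtom "('f, 'v) trm" "('f, 'v) trm"

record ('p, 'f, 'v, 's) signature =
  var_sort :: "'v \<Rightarrow> 's"
  fun_args :: "'f \<Rightarrow> 's list"
  fun_sort :: "'f \<Rightarrow> 's"
  pred_args :: "'p \<Rightarrow> 's list"

inductive has_sort :: "('p, 'f, 'v, 's) signature \<Rightarrow> ('f, 'v) trm \<Rightarrow> 's \<Rightarrow> bool" for \<Sigma> where
  "has_sort \<Sigma> (Var x) (var_sort \<Sigma> x)"
| "list_all2 (has_sort \<Sigma>) ts (fun_args \<Sigma> f) \<Longrightarrow> has_sort \<Sigma> (App f ts) (fun_sort \<Sigma> f)"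

fun well_sorted :: "('p, 'f, 'v, 's) signature \<Rightarrow> ('p, 'f, 'v, 'b) atom \<Rightarrow> bool" where
  "well_sorted \<Sigma> (BoolAtom b) \<longleftrightarrow> True"
| "well_sorted \<Sigma> (PredAtom p ts) \<longleftrightarrow> list_all2 (has_sort \<Sigma>) ts (pred_args \<Sigma> p)"
| "well_sorted \<Sigma> (EqAtom t u) \<longleftrightarrow> (\<exists>s. has_sort \<Sigma> t s \<and> has_sort \<Sigma> u s)"

record ('p, 'f, 's, 'u) struct =
  domain :: "'s \<Rightarrow> 'u set"
  fun_int :: "'f \<Rightarrow> 'u list \<Rightarrow> 'u"
  pred_int :: "'p \<Rightarrow> 'u list \<Rightarrow> bool"

definition is_struct :: "('p, 'f, 'v, 's) signature \<Rightarrow> ('p, 'f, 's, 'u) struct \<Rightarrow> bool" where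
  "is_struct \<Sigma> M \<longleftrightarrow> (\<forall>s. domain M s \<noteq> {}) \<and>
     (\<forall>f us. list_all2 (\<lambda>u s. u \<in> domain M s) us (fun_args \<Sigma> f) \<longrightarrow>
        fun_int M f us \<in> domain M (fun_sort \<Sigma> f))"

definition is_theory :: "('p, 'f, 'v, 's) signature \<Rightarrow> ('p, 'f, 's, 'u) struct set \<Rightarrow> bool" where
  "is_theory \<Sigma> T \<longleftrightarrow> (\<forall>M\<in>T. is_struct \<Sigma> M)"

text \<open>A model of the theory, values for the variables, and truth values for the Boolean atoms.\<close>

type_synonym ('p, 'f, 'v, 'b, 's, 'u) interp =
  "('p, 'f, 's, 'u) struct \<times> ('v \<Rightarrow> 'u) \<times> ('b \<Rightarrow> bool)"

definition interps ::
  "('p, 'f, 'v, 's) signature \<Rightarrow> ('p, 'f, 's, 'u) struct set \<Rightarrow> ('p, 'f, 'v, 'b, 's, 'u) interp set"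
where
  "interps \<Sigma> T = {(M, \<nu>, \<beta>). M \<in> T \<and> (\<forall>x. \<nu> x \<in> domain M (var_sort \<Sigma> x))}"

fun trm_val :: "('p, 'f, 's, 'u) struct \<Rightarrow> ('v \<Rightarrow> 'u) \<Rightarrow> ('f, 'v) trm \<Rightarrow> 'u" where
  "trm_val M \<nu> (Var x) = \<nu> x"
| "trm_val M \<nu> (App f ts) = fun_int M f (map (trm_val M \<nu>) ts)"

fun atom_val :: "('p, 'f, 'v, 'b, 's, 'u) interp \<Rightarrow> ('p, 'f, 'v, 'b) atom \<Rightarrow> bool" where
  "atom_val (M, \<nu>, \<beta>) (BoolAtom b) \<longleftrightarrow> \<beta> b"
| "atom_val (M, \<nu>, \<beta>) (PredAtom p ts) \<longleftrightarrow> pred_int M p (map (trm_val M \<nu>) ts)"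
| "atom_val (M, \<nu>, \<beta>) (EqAtom t u) \<longleftrightarrow> trm_val M \<nu> t = trm_val M \<nu> u"

definition T_satisfiable ::
  "('p, 'f, 'v, 's) signature \<Rightarrow> ('p, 'f, 's, 'u) struct set \<Rightarrow> ('p, 'f, 'v, 'b) atom fm \<Rightarrow> bool"
where
  "T_satisfiable \<Sigma> T f \<longleftrightarrow> (\<exists>I\<in>interps \<Sigma> T. holds (atom_val I) f)"

definition T_valid ::
  "('p, 'f, 'v, 's) signature \<Rightarrow> ('p, 'f, 's, 'u) struct set \<Rightarrow> ('p, 'f, 'v, 'b) atom fm \<Rightarrow> bool"
where
  "T_valid \<Sigma> T f \<longleftrightarrow> (\<forall>I\<in>interps \<Sigma> T. holds (atom_val I) f)"

definition T_entails ::
  "('p, 'f, 'v, 's) signature \<Rightarrow> ('p, 'f, 's, 'u) struct set \<Rightarrow>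
   ('p, 'f, 'v, 'b) atom fm \<Rightarrow> ('p, 'f, 'v, 'b) atom fm \<Rightarrow> bool"
where
  "T_entails \<Sigma> T f g \<longleftrightarrow>
     (\<forall>I\<in>interps \<Sigma> T. holds (atom_val I) f \<longrightarrow> holds (atom_val I) g)"

definition T_inconsistent_assignments ::
  "('p, 'f, 'v, 's) signature \<Rightarrow> ('p, 'f, 's, 'u) struct set \<Rightarrow>
   ('p, 'f, 'v, 'b) atom set \<Rightarrow> ('p, 'f, 'v, 'b) atom fm \<Rightarrow> ('p, 'f, 'v, 'b) atom fm set"
where
  "T_inconsistent_assignments \<Sigma> T \<alpha> \<chi> =
     {\<rho>. total_assignment \<alpha> \<rho> \<and> \<not> T_satisfiable \<Sigma> T \<rho> \<and> entails_p \<rho> \<chi>}"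

definition T_extended ::
  "('p, 'f, 'v, 's) signature \<Rightarrow> ('p, 'f, 's, 'u) struct set \<Rightarrow>
   ('p, 'f, 'v, 'b) atom set \<Rightarrow> ('p, 'f, 'v, 'b) atom fm \<Rightarrow> bool"
where
  "T_extended \<Sigma> T \<alpha> \<psi> \<longleftrightarrow> T_inconsistent_assignments \<Sigma> T \<alpha> (Neg \<psi>) = {}"


section \<open>Formulas as DAGs\<close>

text \<open>
  A DAG is listed in topological order, children before parents; the root is the last node.
  Edges are not labelled, so the children of a node are distinct, and every node other than the
  root has a parent. Sharing need not be maximal.
\<close>

datatype 'a node = NAtom 'a | NNot nat | NAnd "nat list" | NOr "nat list"

type_synonym 'a dag = "'a node list"

fun children :: "'a node \<Rightarrow> nat list" where
  "children (NAtom a) = []"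
| "children (NNot i) = [i]"
| "children (NAnd is) = is"
| "children (NOr is) = is"

definition is_dag :: "'a dag \<Rightarrow> bool" where
  "is_dag ns \<longleftrightarrow> ns \<noteq> [] \<and>
     (\<forall>i<length ns. distinct (children (ns ! i)) \<and> (\<forall>c\<in>set (children (ns ! i)). c < i)) \<and>
     (\<forall>i. Suc i < length ns \<longrightarrow> (\<exists>j<length ns. i \<in> set (children (ns ! j))))"

definition dag_size :: "'a dag \<Rightarrow> nat" where
  "dag_size ns = length ns"

fun node_fm :: "'a fm list \<Rightarrow> 'a node \<Rightarrow> 'a fm" where
  "node_fm fs (NAtom a) = Atom a"
| "node_fm fs (NNot i) = Neg (fs ! i)"
| "node_fm fs (NAnd is) = And (map (\<lambda>i. fs ! i) is)"
| "node_fm fs (NOr is) = Or (map (\<lambda>i. fs ! i) is)"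

definition dag_fms :: "'a dag \<Rightarrow> 'a fm list" where
  "dag_fms ns = foldl (\<lambda>fs n. fs @ [node_fm fs n]) [] ns"

definition dag_fm :: "'a dag \<Rightarrow> 'a fm" where
  "dag_fm ns = last (dag_fms ns)"


section \<open>Polynomial-time computation\<close>

text \<open>
  The machine model is a first-order, call-by-value functional language over binary trees, in the
  style of N. D. Jones (Computability and Complexity from a Programming Perspective). Every
  evaluation step costs one time unit; there are no numbers and no test for equality of trees, and
  subtrees are shared by reference, so that polynomial time in this model is polynomial time on
  Turing machines. A program is a finite list of function bodies, the first of which is the main
  function. The conditional tests whether a tree is a branch, and both projections of a leaf are a
  leaf.
\<close>

datatype tree = Lf | Br tree tree

datatype expr =
    Arg nat
  | ELf
  | EBr expr expr
  | ELeft expr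
  | ERight expr
  | EIf expr expr expr
  | ECall nat "expr list"

type_synonym program = "expr list"

fun left :: "tree \<Rightarrow> tree" where
  "left Lf = Lf"
| "left (Br s t) = s"

fun right :: "tree \<Rightarrow> tree" where
  "right Lf = Lf"
| "right (Br s t) = t"

inductive
  eval :: "program \<Rightarrow> tree list \<Rightarrow> expr \<Rightarrow> tree \<Rightarrow> nat \<Rightarrow> bool" and
  evals :: "program \<Rightarrow> tree list \<Rightarrow> expr list \<Rightarrow> tree list \<Rightarrow> nat \<Rightarrow> bool"
  for P :: program
where
  eval_Arg: "i < length env \<Longrightarrow> eval P env (Arg i) (env ! i) 1"
| eval_Lf: "eval P env ELf Lf 1"
| eval_Br: "eval P env e u k \<Longrightarrow> eval P env e' u' k' \<Longrightarrow>
    eval P env (EBr e e') (Br u u') (Suc (k + k'))"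
| eval_Left: "eval P env e u k \<Longrightarrow> eval P env (ELeft e) (left u) (Suc k)"
| eval_Right: "eval P env e u k \<Longrightarrow> eval P env (ERight e) (right u) (Suc k)"
| eval_If_Br: "eval P env e u k \<Longrightarrow> u \<noteq> Lf \<Longrightarrow> eval P env e1 w k' \<Longrightarrow>
    eval P env (EIf e e1 e2) w (Suc (k + k'))"
| eval_If_Lf: "eval P env e Lf k \<Longrightarrow> eval P env e2 w k' \<Longrightarrow>
    eval P env (EIf e e1 e2) w (Suc (k + k'))"
| eval_Call: "g < length P \<Longrightarrow> evals P env es us k \<Longrightarrow> eval P us (P ! g) w k' \<Longrightarrow>
    eval P env (ECall g es) w (Suc (k + k'))"
| evals_Nil: "evals P env [] [] 0"
| evals_Cons: "eval P env e u k \<Longrightarrow> evals P env es us k' \<Longrightarrow>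
    evals P env (e # es) (u # us) (k + k')"

lemma eval_deterministic:
  "eval P env e u k \<Longrightarrow> eval P env e u' k' \<Longrightarrow> u = u' \<and> k = k'"
  "evals P env es us k \<Longrightarrow> evals P env es us' k' \<Longrightarrow> us = us' \<and> k = k'"
proof (induction arbitrary: u' k' and us' k' rule: eval_evals.inducts)
  case (eval_Arg i env)
  then show ?case by (auto elim: eval.cases)
next
  case (eval_Lf env)
  then show ?case by (auto elim: eval.cases)
next
  case (eval_Br env e u k e' u' k')
  from eval_Br.prems show ?case by (cases rule: eval.cases) (use eval_Br.IH in blast)+
next
  case (eval_Left env e u k)
  from eval_Left.prems show ?case by (cases rule: eval.cases) (use eval_Left.IH in blast)+
next
  case (eval_Right env e u k)
  from eval_Right.prems show ?case by (cases rule: eval.cases) (use eval_Right.IH in blast)+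
next
  case (eval_If_Br env e u k e1 w k' e2)
  from eval_If_Br.prems show ?case
    by (cases rule: eval.cases) (use eval_If_Br.IH eval_If_Br.hyps in blast)+
next
  case (eval_If_Lf env e k e2 w k' e1)
  from eval_If_Lf.prems show ?case by (cases rule: eval.cases) (use eval_If_Lf.IH in blast)+
next
  case (eval_Call g env es us k w k')
  from eval_Call.prems show ?case by (cases rule: eval.cases) (use eval_Call.IH in blast)+
next
  case (evals_Nil env)
  then show ?case by (auto elim: evals.cases)
next
  case (evals_Cons env e u k es us k')
  from evals_Cons.prems show ?case by (cases rule: evals.cases) (use evals_Cons.IH in blast)+
qed

definition decides_within :: "program \<Rightarrow> tree list \<Rightarrow> bool \<Rightarrow> nat \<Rightarrow> bool" where
  "decides_within P inputs b n \<longleftrightarrow> P \<noteq> [] \<and>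
     (\<exists>u k. eval P inputs (hd P) u k \<and> k \<le> n \<and> (u \<noteq> Lf \<longleftrightarrow> b))"

text \<open>
  Numbers are written in unary. They occur as node indices and as names of atoms only, hence are
  bounded by the number of nodes.
\<close>

primrec enc_nat :: "nat \<Rightarrow> tree" where
  "enc_nat 0 = Lf"
| "enc_nat (Suc n) = Br Lf (enc_nat n)"

definition enc_list :: "tree list \<Rightarrow> tree" where
  "enc_list us = foldr Br us Lf"

fun enc_node :: "('a \<Rightarrow> nat) \<Rightarrow> 'a node \<Rightarrow> tree" where
  "enc_node num (NAtom a) = Br (enc_nat 0) (enc_nat (num a))"
| "enc_node num (NNot i) = Br (enc_nat 1) (enc_nat i)"
| "enc_node num (NAnd is) = Br (enc_nat 2) (enc_list (map enc_nat is))"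
| "enc_node num (NOr is) = Br (enc_nat 3) (enc_list (map enc_nat is))"

definition enc_dag :: "('a \<Rightarrow> nat) \<Rightarrow> 'a dag \<Rightarrow> tree" where
  "enc_dag num ns = enc_list (map (enc_node num) ns)"

text \<open>The Boolean variables of the abstraction, named by the numbers below their count.\<close>

definition is_numbering :: "('a \<Rightarrow> nat) \<Rightarrow> 'a set \<Rightarrow> bool" where
  "is_numbering num A \<longleftrightarrow> bij_betw num A {..<card A}"

end

theory Submission
  imports Defs
begin

text \<open>
  If \<open>\<psi>\<close> is \<open>T\<close>-extended, an assignment falsifying \<open>\<psi>\<close> but satisfying \<open>\<gamma>\<close> is \<open>T\<close>-satisfiable, so
  \<open>\<gamma> \<Turnstile>\<^sub>T \<psi>\<close> is propositional entailment; validity is the case of the empty cube.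

  Unless \<open>\<gamma>\<close> contains complementary literals, \<open>\<gamma> \<Turnstile>\<^sub>p \<psi>\<close> holds iff \<open>\<psi>\<close> has probability \<open>1\<close> when the
  atoms fixed by \<open>\<gamma>\<close> get weight \<open>0\<close> or \<open>1\<close> and the others weight \<open>1/2\<close>. In a d-DNNF the probability of
  a conjunction is the product and that of a disjunction the sum of the probabilities of the
  children. With \<open>n\<close> nodes all probabilities are multiples of \<open>1/2\<^sup>n\<close>, so binary fixed-point
  arithmetic on \<open>n + 1\<close> bits is exact, and one pass over the DAG takes polynomial time.
\<close>

section \<open>From theory entailment to propositional entailment\<close>

text \<open>The theory enters only through the reduction to propositional entailment; the program
  never consults it. Comparing raw model counts would force the children of a disjunction to mention
  the same atoms. Fractions of one fixed space, the subsets of the atoms of \<psi>, avoid this,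
  since an unmentioned atom changes no fraction. Every atom of \<psi> labels a node, so there are at
  most n atoms and each fraction is a multiple of \<open>1 / 2 ^ n\<close>. A product of children is
  itself such a fraction, that of a conjunction, so rounding down after a multiplication loses
  nothing. Complementary literals need a test of their own: such a cube entails everything, while
  the weights would give 1 to both literals. Atoms are known to the program only by unary names, so
  the sign of an atom in \<gamma> is found by one pass over the DAG of \<gamma>, whatever sharing it
  contains.\<close>

lemma holds_cong: "(\<And>a. a \<in> atoms f \<Longrightarrow> v a = w a) \<Longrightarrow> holds v f = holds w f"
  by (induction f) auto

lemma holds_map_fm: "holds v (map_fm h f) = holds (\<lambda>a. v (h a)) f"
  by (induction f) auto

lemma entails_p_iff: "entails_p f g \<longleftrightarrow> prop_entails f g"
proof
  assume L: "entails_p f g"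
  show "prop_entails f g"
    unfolding prop_entails_def
  proof (intro allI impI)
    fix v assume "holds v f"
    then have "holds (\<lambda>x. case x of BVar a \<Rightarrow> v a) (abstraction f)"
      by (simp add: abstraction_def holds_map_fm)
    then have "holds (\<lambda>x. case x of BVar a \<Rightarrow> v a) (abstraction g)"
      using L by (simp add: entails_p_def prop_entails_def)
    then show "holds v g" by (simp add: abstraction_def holds_map_fm)
  qed
next
  show "prop_entails f g \<Longrightarrow> entails_p f g"
    by (simp add: entails_p_def prop_entails_def abstraction_def holds_map_fm)
qed

lemma T_entails_iff_prop_entails:
  fixes \<psi> \<gamma> :: "('p, 'f, 'v, 'b) atom fm"
  assumes "finite \<alpha>" "atoms \<psi> \<subseteq> \<alpha>" "atoms \<gamma> \<subseteq> \<alpha>" "T_extended \<Sigma> T \<alpha> \<psi>"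
  shows "T_entails \<Sigma> T \<gamma> \<psi> \<longleftrightarrow> prop_entails \<gamma> \<psi>"
proof
  show "prop_entails \<gamma> \<psi> \<Longrightarrow> T_entails \<Sigma> T \<gamma> \<psi>"
    by (simp add: prop_entails_def T_entails_def)
next
  assume T: "T_entails \<Sigma> T \<gamma> \<psi>"
  show "prop_entails \<gamma> \<psi>"
    unfolding prop_entails_def
  proof (intro allI impI, rule ccontr)
    fix v assume v: "holds v \<gamma>" "\<not> holds v \<psi>"
    obtain xs where xs: "set xs = \<alpha>" using finite_list[OF assms(1)] by blast
    \<comment> \<open>The restriction of \<open>v\<close> to \<alpha>, a finite conjunction. It
      propositionally entails \<open>Neg \<psi>\<close>, so T-extendedness gives it a T-model, which
      agrees with \<open>v\<close> on \<alpha>.\<close>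
    define \<rho> where "\<rho> = And (map (\<lambda>a. if v a then Atom a else Neg (Atom a)) xs)"
    have agree: "w a = v a" if "holds w \<rho>" "a \<in> \<alpha>" for w a
    proof -
      have "holds w (if v a then Atom a else Neg (Atom a))" using that xs by (simp add: \<rho>_def)
      then show ?thesis by (simp split: if_splits)
    qed
    have "total_assignment \<alpha> \<rho>"
      unfolding total_assignment_def \<rho>_def using xs
      by (auto simp: is_literal_def image_iff split: if_splits)
    moreover have "entails_p \<rho> (Neg \<psi>)"
      unfolding entails_p_iff prop_entails_def
      using agree v(2) assms(2) by (metis holds.simps(2) holds_cong subsetD)
    ultimately have "T_satisfiable \<Sigma> T \<rho>"
      using assms(4) by (auto simp: T_extended_def T_inconsistent_assignments_def)
    then obtain I where I: "I \<in> interps \<Sigma> T" "holds (atom_val I) \<rho>"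
      by (auto simp: T_satisfiable_def)
    have "holds (atom_val I) \<gamma>" "\<not> holds (atom_val I) \<psi>"
      using holds_cong[of \<gamma> "atom_val I" v] holds_cong[of \<psi> "atom_val I" v] agree[OF I(2)] assms v
      by blast+
    then show False using T I(1) by (auto simp: T_entails_def)
  qed
qed

section \<open>Recursive form of d-DNNF, obtained from the abstraction\<close>

lemma subfms_self [simp]: "f \<in> subfms f"
  by (cases f) auto

text \<open>\<open>d_DNNF\<close> quantifies over all subformulas at once; conditions stated node by
  node suit induction over the formula. Both relations are symmetric, so \<open>sorted_wrt\<close>
  covers all pairs of positions.\<close>

fun struct_d_DNNF :: "'a fm \<Rightarrow> bool" where
  "struct_d_DNNF (Atom a) \<longleftrightarrow> True"
| "struct_d_DNNF (Neg f) \<longleftrightarrow> (\<exists>a. f = Atom a)"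
| "struct_d_DNNF (And fs) \<longleftrightarrow>
     sorted_wrt (\<lambda>f g. atoms f \<inter> atoms g = {}) fs \<and> (\<forall>f\<in>set fs. struct_d_DNNF f)"
| "struct_d_DNNF (Or fs) \<longleftrightarrow>
     sorted_wrt prop_inconsistent fs \<and> (\<forall>f\<in>set fs. struct_d_DNNF f)"

lemma prop_inconsistent_map_fm:
  "prop_inconsistent (map_fm BVar f) (map_fm BVar g) \<longleftrightarrow> prop_inconsistent f g"
proof -
  have "(\<exists>v. holds (\<lambda>a. v (BVar a)) f \<and> holds (\<lambda>a. v (BVar a)) g) \<longleftrightarrow> (\<exists>v. holds v f \<and> holds v g)"
  proof
    assume "\<exists>v. holds v f \<and> holds v g"
    then obtain v where "holds v f \<and> holds v g" by blast
    then show "\<exists>v. holds (\<lambda>a. v (BVar a)) f \<and> holds (\<lambda>a. v (BVar a)) g"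
      \<comment> \<open>Any valuation of the atoms comes from one of the Boolean variables, by
        undoing \<open>BVar\<close>.\<close>
      by (intro exI[of _ "\<lambda>x. case x of BVar a \<Rightarrow> v a"]) simp
  qed blast
  then show ?thesis by (simp add: prop_inconsistent_def holds_map_fm)
qed

lemma d_DNNF_And_D:
  assumes "d_DNNF (And fs)"
  shows "sorted_wrt (\<lambda>f g. atoms f \<inter> atoms g = {}) fs \<and> (\<forall>f\<in>set fs. d_DNNF f)"
proof -
  have sub: "subfms f \<subseteq> subfms (And fs)" if "f \<in> set fs" for f using that by auto
  have "d_DNNF f" if "f \<in> set fs" for f
    using assms sub[OF that] unfolding d_DNNF_def nnf_def decomposable_def deterministic_def by blast
  moreover have "\<forall>i j. i < j \<and> j < length fs \<longrightarrow> atoms (fs ! i) \<inter> atoms (fs ! j) = {}"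
    using assms subfms_self[of "And fs"] unfolding d_DNNF_def decomposable_def by blast
  ultimately show ?thesis by (simp add: sorted_wrt_iff_nth_less)
qed

lemma d_DNNF_Or_D:
  assumes "d_DNNF (Or fs)"
  shows "sorted_wrt prop_inconsistent fs \<and> (\<forall>f\<in>set fs. d_DNNF f)"
proof -
  have sub: "subfms f \<subseteq> subfms (Or fs)" if "f \<in> set fs" for f using that by auto
  have "d_DNNF f" if "f \<in> set fs" for f
    using assms sub[OF that] unfolding d_DNNF_def nnf_def decomposable_def deterministic_def by blast
  moreover have "\<forall>i j. i < j \<and> j < length fs \<longrightarrow> prop_inconsistent (fs ! i) (fs ! j)"
    using assms subfms_self[of "Or fs"] unfolding d_DNNF_def deterministic_def by blast
  ultimately show ?thesis by (simp add: sorted_wrt_iff_nth_less)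
qed

text \<open>The conditions pass down to children; a shared atom would have a shared image under
  \<open>BVar\<close>, and renaming does not affect inconsistency.\<close>

lemma struct_d_DNNF_if_abstraction: "d_DNNF (map_fm BVar f) \<Longrightarrow> struct_d_DNNF f"
proof (induction f)
  case (Neg f)
  then show ?case by (cases f) (auto simp: d_DNNF_def nnf_def)
next
  case (And fs)
  have "sorted_wrt (\<lambda>f g. atoms f \<inter> atoms g = {}) fs"
  proof -
    have "sorted_wrt (\<lambda>f g. BVar ` atoms f \<inter> BVar ` atoms g = {}) fs"
      using d_DNNF_And_D[OF And.prems[simplified]] by (simp add: sorted_wrt_map fm.set_map)
    then show ?thesis by (rule sorted_wrt_mono_rel[rotated]) blast
  qed
  then show ?case using And d_DNNF_And_D[OF And.prems[simplified]] by simp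
next
  case (Or fs)
  then show ?case using d_DNNF_Or_D[OF Or.prems[simplified]]
    by (simp add: sorted_wrt_map prop_inconsistent_map_fm)
qed simp

section \<open>The atoms of a DAG\<close>

lemma length_dag_fms_aux:
  "length (foldl (\<lambda>fs n. fs @ [node_fm fs n]) gs ns) = length gs + length ns"
  by (induction ns arbitrary: gs) auto

lemma length_dag_fms [simp]: "length (dag_fms ns) = length ns"
  by (simp add: dag_fms_def length_dag_fms_aux)

lemma dag_fms_snoc: "dag_fms (ns @ [x]) = dag_fms ns @ [node_fm (dag_fms ns) x]"
  by (simp add: dag_fms_def)

text \<open>Formulas are only appended, so the formula of a node depends on the nodes up to it
  alone.\<close>

lemma take_dag_fms: "take i (dag_fms ns) = dag_fms (take i ns)"
proof (induction ns rule: rev_induct)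
  case (snoc x ns)
  then show ?case by (cases "i \<le> length ns") (auto simp: dag_fms_snoc)
qed (simp add: dag_fms_def)

lemma nth_dag_fms:
  assumes "i < length ns"
  shows "dag_fms ns ! i = node_fm (dag_fms (take i ns)) (ns ! i)"
proof -
  have "dag_fms ns ! i = take (Suc i) (dag_fms ns) ! i" by simp
  also have "\<dots> = dag_fms (take i ns @ [ns ! i]) ! i"
    using assms by (simp add: take_dag_fms take_Suc_conv_app_nth)
  finally show ?thesis using assms by (simp add: dag_fms_snoc nth_append)
qed

lemma atoms_dag_fms_child:
  assumes "is_dag ns" "j < length ns" "i \<in> set (children (ns ! j))"
  shows "i < j" "atoms (dag_fms ns ! i) \<subseteq> atoms (dag_fms ns ! j)"
proof -
  show ij: "i < j" using assms by (auto simp: is_dag_def)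
  have "dag_fms (take j ns) ! i = dag_fms ns ! i"
    using ij by (simp flip: take_dag_fms)
  then show "atoms (dag_fms ns ! i) \<subseteq> atoms (dag_fms ns ! j)"
    using assms by (cases "ns ! j") (auto simp: nth_dag_fms)
qed

lemma dag_fm_nth: "ns \<noteq> [] \<Longrightarrow> dag_fm ns = dag_fms ns ! (length ns - 1)"
  by (metis dag_fm_def last_conv_nth length_0_conv length_dag_fms)

text \<open>Every node but the last has a parent, which stands later in the list, so climbing ends
  at the root; the induction is on the distance to the end.\<close>

lemma atoms_dag_fms_root:
  assumes "is_dag ns" "i < length ns"
  shows "atoms (dag_fms ns ! i) \<subseteq> atoms (dag_fm ns)"
  using assms(2)
proof (induction "length ns - i" arbitrary: i rule: less_induct)
  case less
  show ?case
  proof (cases "Suc i < length ns")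
    case True
    then obtain j where "j < length ns" "i \<in> set (children (ns ! j))"
      using assms(1) by (auto simp: is_dag_def)
    with atoms_dag_fms_child[OF assms(1) this] less show ?thesis
      by (meson diff_less_mono2 order_trans)
  next
    case False
    then have "i = length ns - 1" using less by simp
    then show ?thesis using less dag_fm_nth[of ns] by (metis length_pos_if_in_set list.size(3) not_less_zero subset_refl)
  qed
qed

lemma atoms_dag_fms_nodes: 
  "i < length ns \<Longrightarrow> is_dag ns \<Longrightarrow> atoms (dag_fms ns ! i) \<subseteq> {a. NAtom a \<in> set ns}"
proof (induction i rule: less_induct)
  case (less i)
  have "dag_fms (take i ns) ! c = dag_fms ns ! c" "c < i" if "c \<in> set (children (ns ! i))" for c
    using atoms_dag_fms_child[OF less.prems(2,1) that] by (simp_all flip: take_dag_fms)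
  then have c: "atoms (dag_fms (take i ns) ! c) \<subseteq> {a. NAtom a \<in> set ns}"
    if "c \<in> set (children (ns ! i))" for c
    using less that by simp
  have "ns ! i \<in> set ns" using less by simp
  with c less.prems(1) show ?case
    by (cases "ns ! i") (simp_all add: nth_dag_fms UN_subset_iff)
qed

text \<open>Rests on all nodes being reachable from the root. It bounds the number of atoms by the
  number of nodes and lets the program enumerate the atoms of a cube by scanning nodes.\<close>

lemma atoms_dag_fm:
  assumes "is_dag ns"
  shows "atoms (dag_fm ns) = {a. NAtom a \<in> set ns}"
proof
  have ne: "ns \<noteq> []" using assms by (simp add: is_dag_def)
  then show "atoms (dag_fm ns) \<subseteq> {a. NAtom a \<in> set ns}"
    using atoms_dag_fms_nodes[OF _ assms, of "length ns - 1"] by (simp add: dag_fm_nth)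
  show "{a. NAtom a \<in> set ns} \<subseteq> atoms (dag_fm ns)"
  proof
    fix a assume "a \<in> {a. NAtom a \<in> set ns}"
    then obtain i where "i < length ns" "ns ! i = NAtom a" by (auto simp: in_set_conv_nth)
    then show "a \<in> atoms (dag_fm ns)"
      using atoms_dag_fms_root[OF assms, of i] by (simp add: nth_dag_fms)
  qed
qed

lemma card_atoms_dag_fm:
  assumes "is_dag ns"
  shows "finite (atoms (dag_fm ns))" "card (atoms (dag_fm ns)) \<le> length ns"
proof -
  have sub: "NAtom ` atoms (dag_fm ns) \<subseteq> set ns" using assms by (auto simp: atoms_dag_fm)
  have inj: "inj_on NAtom (atoms (dag_fm ns))" by (simp add: inj_on_def)
  show "finite (atoms (dag_fm ns))" using sub inj by (meson finite_imageD finite_set finite_subset)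
  have "card (atoms (dag_fm ns)) \<le> card (set ns)"
    using card_inj_on_le[OF inj sub] by simp
  then show "card (atoms (dag_fm ns)) \<le> length ns" using card_length[of ns] by linarith
qed

text \<open>\<open>dag_size\<close> does not count edges; distinct children of smaller index keep
  them polynomial in the number of nodes.\<close>

lemma length_children_le:
  assumes "is_dag ns" "x \<in> set ns"
  shows "length (children x) \<le> length ns"
proof -
  obtain i where i: "i < length ns" "x = ns ! i" using assms(2) by (auto simp: in_set_conv_nth)
  then have "distinct (children x)" "set (children x) \<subseteq> {..<i}" using assms(1) by (auto simp: is_dag_def)
  then have "length (children x) \<le> card {..<i}" by (metis card_mono distinct_card finite_lessThan)
  then show ?thesis using i by simp
qed

section \<open>Weighted model counting\<close>

text \<open>Bit lists are little-endian.\<close>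

fun bits_val :: "bool list \<Rightarrow> nat" where
  "bits_val [] = 0"
| "bits_val (x # xs) = of_bool x + 2 * bits_val xs"

lemma bits_val_less: "bits_val xs < 2 ^ length xs"
  by (induction xs) auto

lemma bits_val_replicate: "bits_val (replicate k False @ xs) = 2 ^ k * bits_val xs"
  by (induction k) auto

lemma bits_val_tl: "bits_val (tl xs) = bits_val xs div 2"
  by (cases xs) auto

text \<open>On \<open>n + 1\<close> bits the last one counts \<open>2 ^ n\<close>, the fixed-point
  1, so probability 1 is tested by reading one bit.\<close>

lemma last_bit_iff: "xs \<noteq> [] \<Longrightarrow> last xs \<longleftrightarrow> 2 ^ (length xs - 1) \<le> bits_val xs"
proof (induction xs)
  case (Cons x xs)
  show ?case
  proof (cases xs)
    case (Cons y ys)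
    with Cons.IH have "last (x # xs) \<longleftrightarrow> 2 ^ length ys \<le> bits_val xs" by simp
    \<comment> \<open>The bound is even, so the lowest bit cannot decide the comparison.\<close>
    moreover have "2 * 2 ^ length ys \<le> of_bool x + 2 * bits_val xs \<longleftrightarrow> 2 ^ length ys \<le> bits_val xs"
      by (cases x) (simp, presburger, simp)
    ultimately show ?thesis using Cons by simp
  qed simp
qed simp

definition xor3 :: "bool \<Rightarrow> bool \<Rightarrow> bool \<Rightarrow> bool" where
  "xor3 a b c \<longleftrightarrow> (a = (b = c))"

definition maj :: "bool \<Rightarrow> bool \<Rightarrow> bool \<Rightarrow> bool" where
  "maj a b c \<longleftrightarrow> (if a then b \<or> c else b \<and> c)"

text \<open>\<open>c + y \<cdot> xs + zs\<close> for a carry \<open>c\<close> and a bit \<open>y\<close>, truncated to the width of \<open>xs\<close>.\<close>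

fun add :: "bool \<Rightarrow> bool \<Rightarrow> bool list \<Rightarrow> bool list \<Rightarrow> bool list" where
  "add c y [] zs = []"
| "add c y (x # xs) zs =
     xor3 c (y \<and> x) (zs \<noteq> [] \<and> hd zs) # add (maj c (y \<and> x) (zs \<noteq> [] \<and> hd zs)) y xs (tl zs)"

lemma length_add [simp]: "length (add c y xs zs) = length xs"
  by (induction c y xs zs rule: add.induct) auto

text \<open>The gate \<open>y\<close> makes one routine serve as plain sum (\<open>y = True\<close>)
  and as one row of the schoolbook product. Past its end \<open>zs\<close> reads as zeros, so
  \<open>[]\<close> is a zero of any width, the initial accumulator of \<open>mul\<close>.\<close>

lemma bits_val_add:
  "bits_val (add c y xs zs) = (of_bool c + of_bool y * bits_val xs + bits_val zs) mod 2 ^ length xs"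
proof (induction c y xs zs rule: add.induct)
  case (2 c y x xs zs)
  define z where "z = (zs \<noteq> [] \<and> hd zs)"
  \<comment> \<open>What the higher positions have to add, including the carry out of the lowest
    one.\<close>
  define Q where "Q = of_bool (maj c (y \<and> x) z) + of_bool y * bits_val xs + bits_val (tl zs)"
  have zs: "bits_val zs = of_bool z + 2 * bits_val (tl zs)"
    by (cases zs) (auto simp: z_def)
  have "of_bool c + of_bool y * bits_val (x # xs) + bits_val zs = of_bool (xor3 c (y \<and> x) z) + 2 * Q"
    unfolding zs Q_def by (cases c; cases y; cases x; cases z) (auto simp: xor3_def maj_def)
  moreover have "(of_bool b + 2 * Q) mod (2 * m) = of_bool b + 2 * (Q mod m)" for b :: bool and m :: nat
    by (cases b) (simp_all add: mod_mult2_eq)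
  ultimately show ?case using 2 by (simp add: z_def[symmetric] Q_def)
qed simp

text \<open>
  The accumulator is halved after each bit of the multiplier but the last, so for numbers of
  \<open>n + 1\<close> bits this is the product of fixed-point numbers with unit \<open>2\<^sup>n\<close>.
\<close>

fun mul :: "bool list \<Rightarrow> bool list \<Rightarrow> bool list \<Rightarrow> bool list" where
  "mul acc xs [] = add False False xs acc"
| "mul acc xs [y] = add False y xs acc"
| "mul acc xs (y # y' # ys) = mul (tl (add False y xs acc)) xs (y' # ys)"

lemma length_mul [simp]: "length (mul acc xs ys) = length xs"
  by (induction acc xs ys rule: mul.induct) auto

text \<open>
  Halving the accumulator after each bit discards low-order bits, but nested floor divisions
  compose, so the result is the exact quotient; the first bound rules out overflow.
\<close>

lemma bits_val_mul:
  assumes "bits_val acc < bits_val xs \<or> bits_val acc = 0" "2 * bits_val xs \<le> 2 ^ length xs" "ys \<noteq> []"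
  shows "bits_val (mul acc xs ys) = (bits_val acc + bits_val xs * bits_val ys) div 2 ^ (length ys - 1)"
  using assms
proof (induction acc xs ys rule: mul.induct)
  case (2 acc xs y)
  then have "of_bool y * bits_val xs + bits_val acc < 2 ^ length xs"
    using bits_val_less[of xs] by (cases y) auto
  then show ?case by (simp add: bits_val_add algebra_simps)
next
  case (3 acc xs y y' ys)
  let ?X = "bits_val xs" and ?A = "bits_val acc" and ?Y = "bits_val (y' # ys)"
  have "of_bool y * ?X + ?A < 2 ^ length xs"
    using 3 bits_val_less[of xs] by (cases y) auto
  then have s: "bits_val (tl (add False y xs acc)) = (of_bool y * ?X + ?A) div 2"
    by (simp add: bits_val_add bits_val_tl)
  \<comment> \<open>An accumulator below \<open>?X\<close> makes a sum below \<open>2 * ?X\<close>,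
    whose half is again below \<open>?X\<close>. The second alternative covers
    \<open>?X = 0\<close>.\<close>
  have "(of_bool y * ?X + ?A) div 2 < ?X \<or> (of_bool y * ?X + ?A) div 2 = 0"
    using 3 by (cases y) auto
  then have "bits_val (mul acc xs (y # y' # ys)) =
      ((of_bool y * ?X + ?A) div 2 + ?X * ?Y) div 2 ^ (length (y' # ys) - 1)"
    using 3 s by simp
  \<comment> \<open>An integer summand moves inside the floor, after which the two divisions
    merge.\<close>
  also have "(of_bool y * ?X + ?A) div 2 + ?X * ?Y = (of_bool y * ?X + ?A + 2 * (?X * ?Y)) div 2"
    by simp
  also have "of_bool y * ?X + ?A + 2 * (?X * ?Y) = ?A + ?X * bits_val (y # y' # ys)"
    by (simp add: algebra_simps)
  finally show ?case by (simp only: div_mult2_eq[symmetric]) simp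
qed simp

definition zero_bits :: "nat \<Rightarrow> bool list" where
  "zero_bits n = replicate n False @ [False]"

definition one_bits :: "nat \<Rightarrow> bool list" where
  "one_bits n = replicate n False @ [True]"

text \<open>In units of \<open>2 ^ n\<close>, 1/2 is bit \<open>n - 1\<close> of
  \<open>n + 1\<close> bits; the width is right only for \<open>0 < n\<close>.\<close>

definition half_bits :: "nat \<Rightarrow> bool list" where
  "half_bits n = replicate (n - 1) False @ [True, False]"

definition lit_bits :: "nat \<Rightarrow> bool \<Rightarrow> bool \<Rightarrow> bool list" where
  "lit_bits n p q = (if p then one_bits n else if q then zero_bits n else half_bits n)"

text \<open>
  \<open>pol a\<close> tells whether the cube contains \<open>a\<close> and whether it contains \<open>\<not> a\<close>. The second component is
  the weight of the negation, which is needed at atoms only and junk at other nodes.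
\<close>

fun weight :: "nat \<Rightarrow> ('a \<Rightarrow> bool \<times> bool) \<Rightarrow> 'a fm \<Rightarrow> bool list \<times> bool list" where
  "weight n pol (Atom a) =
     (lit_bits n (fst (pol a)) (snd (pol a)), lit_bits n (snd (pol a)) (fst (pol a)))"
| "weight n pol (Neg f) = prod.swap (weight n pol f)"
| "weight n pol (And fs) = (foldr (mul []) (map (\<lambda>f. fst (weight n pol f)) fs) (one_bits n), [])"
| "weight n pol (Or fs) = (foldr (add False True) (map (\<lambda>f. fst (weight n pol f)) fs) (zero_bits n), [])"

lemma length_lit_bits: "0 < n \<Longrightarrow> length (lit_bits n p q) = Suc n"
  by (simp add: lit_bits_def one_bits_def zero_bits_def half_bits_def)

text \<open>Only an upper bound, since a negated compound formula gets \<open>[]\<close>; but it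
  covers arbitrary formulas, as the running times of \<open>call_sum\<close> and
  \<open>call_prod\<close> require. In both folds the first child determines the width.\<close>

lemma length_weight:
  "0 < n \<Longrightarrow> length (fst (weight n pol f)) \<le> Suc n \<and> length (snd (weight n pol f)) \<le> Suc n"
proof (induction f)
  case (And fs)
  have "length (foldr (mul []) xs (one_bits n)) \<le> Suc n" if "\<forall>x\<in>set xs. length x \<le> Suc n" for xs
    using that by (cases xs) (auto simp: one_bits_def)
  with And show ?case by simp
next
  case (Or fs)
  have "length (foldr (add False True) xs (zero_bits n)) \<le> Suc n" if "\<forall>x\<in>set xs. length x \<le> Suc n" for xs
    using that by (cases xs) (auto simp: zero_bits_def)
  with Or show ?case by simp
qed (auto simp: length_lit_bits)

text \<open>\<open>S\<close> is drawn uniformly from the subsets of the atoms and overridden by the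
  cube. Counting such \<open>S\<close> thus realises the weights 0, 1 and 1/2.\<close>

definition val_of :: "('a \<Rightarrow> bool \<times> bool) \<Rightarrow> 'a set \<Rightarrow> 'a \<Rightarrow> bool" where
  "val_of pol S a \<longleftrightarrow> fst (pol a) \<or> (\<not> snd (pol a) \<and> a \<in> S)"

definition models :: "('a \<Rightarrow> bool \<times> bool) \<Rightarrow> 'a set \<Rightarrow> 'a fm \<Rightarrow> 'a set set" where
  "models pol A f = {S. S \<subseteq> A \<and> holds (val_of pol S) f}"

lemma models_subset: "models pol A f \<subseteq> Pow A"
  by (auto simp: models_def)

lemma finite_models: "finite A \<Longrightarrow> finite (models pol A f)"
  by (metis finite_Pow_iff finite_subset models_subset)

lemma card_models_le: "finite A \<Longrightarrow> card (models pol A f) \<le> 2 ^ card A"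
  by (metis card_Pow card_mono finite_Pow_iff models_subset)

text \<open>Swapping the parts outside \<open>B\<close> of two subsets turns a model of both and an arbitrary subset into a model of each.\<close>

lemma card_independent:
  assumes "finite A"
    and p: "\<And>S S'. S \<inter> B = S' \<inter> B \<Longrightarrow> p S = p S'"
    and q: "\<And>S S'. S - B = S' - B \<Longrightarrow> q S = q S'"
  shows "card {S. S \<subseteq> A \<and> p S} * card {S. S \<subseteq> A \<and> q S} = 2 ^ card A * card {S. S \<subseteq> A \<and> p S \<and> q S}"
proof -
  define h where "h = (\<lambda>(S, S'). ((S \<inter> B) \<union> (S' - B), (S' \<inter> B) \<union> (S - B)))"
  have hh: "h (h x) = x" for x by (cases x) (auto simp: h_def)
  let ?L = "{S. S \<subseteq> A \<and> p S} \<times> {S. S \<subseteq> A \<and> q S}" and ?R = "{S. S \<subseteq> A \<and> p S \<and> q S} \<times> Pow A"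
  have pq: "p (S \<inter> B \<union> (S' - B)) = p S" "q (S \<inter> B \<union> (S' - B)) = q S'" for S S'
    by (rule p, blast) (rule q, blast)
  have "bij_betw h ?L ?R"
  proof (rule bij_betw_byWitness[where f' = h])
    show "h ` ?L \<subseteq> ?R" "h ` ?R \<subseteq> ?L" by (auto simp: h_def pq)
  qed (simp_all add: hh)
  then have "card ?L = card ?R" by (rule bij_betw_same_card)
  then show ?thesis using assms(1) by (simp add: card_cartesian_product card_Pow)
qed

text \<open>Independence with \<open>B = atoms f\<close>: \<open>f\<close> looks at \<open>S\<close>
  only inside \<open>B\<close>, the other conjuncts only outside.\<close>

lemma card_models_And_Cons:
  assumes "finite A" "\<forall>g\<in>set fs. atoms f \<inter> atoms g = {}"
  shows "card (models pol A f) * card (models pol A (And fs)) = 2 ^ card A * card (models pol A (And (f # fs)))"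
proof -
  have 1: "holds (val_of pol S) f = holds (val_of pol S') f" if "S \<inter> atoms f = S' \<inter> atoms f" for S S'
    by (rule holds_cong) (use that in \<open>auto simp: val_of_def\<close>)
  have 2: "holds (val_of pol S) (And fs) = holds (val_of pol S') (And fs)" if "S - atoms f = S' - atoms f" for S S'
    by (rule holds_cong) (use that assms(2) in \<open>auto simp: val_of_def\<close>)
  show ?thesis
    using card_independent[OF assms(1) 1 2] by (simp add: models_def)
qed

lemma card_models_Or_Cons:
  assumes "finite A" "\<forall>g\<in>set fs. prop_inconsistent f g"
  shows "card (models pol A (Or (f # fs))) = card (models pol A f) + card (models pol A (Or fs))"
proof -
  have "models pol A (Or (f # fs)) = models pol A f \<union> models pol A (Or fs)"
    by (auto simp: models_def)
  moreover have "models pol A f \<inter> models pol A (Or fs) = {}"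
    using assms(2) by (auto simp: models_def prop_inconsistent_def)
  ultimately show ?thesis using assms(1) by (simp add: card_Un_disjoint finite_models)
qed

lemma card_subsets_containing:
  assumes "finite A" "a \<in> A"
  shows "2 * card {S. S \<subseteq> A \<and> a \<in> S} = 2 ^ card A" "2 * card {S. S \<subseteq> A \<and> a \<notin> S} = 2 ^ card A"
proof -
  have e: "{S. S \<subseteq> A \<and> a \<notin> S} = Pow (A - {a})" by auto
  have "2 * 2 ^ card (A - {a}) = (2::nat) ^ card A" using card_Suc_Diff1[OF assms] by (metis power_Suc)
  moreover have "card (Pow (A - {a})) = 2 ^ card (A - {a})" using assms by (intro card_Pow) simp
  ultimately show 2: "2 * card {S. S \<subseteq> A \<and> a \<notin> S} = 2 ^ card A"
    unfolding e by metis
  have "Pow A = {S. S \<subseteq> A \<and> a \<in> S} \<union> {S. S \<subseteq> A \<and> a \<notin> S}" by auto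
  then have "2 ^ card A = card ({S. S \<subseteq> A \<and> a \<in> S} \<union> {S. S \<subseteq> A \<and> a \<notin> S})"
    using card_Pow[OF assms(1)] by simp
  also have "\<dots> = card {S. S \<subseteq> A \<and> a \<in> S} + card {S. S \<subseteq> A \<and> a \<notin> S}"
    using assms(1) by (intro card_Un_disjoint) auto
  finally show "2 * card {S. S \<subseteq> A \<and> a \<in> S} = 2 ^ card A" using 2 by simp
qed

lemma bits_val_lit_bits:
  "0 < n \<Longrightarrow> bits_val (lit_bits n p q) = (if p then 2 ^ n else if q then 0 else 2 ^ (n - 1))"
  by (simp add: lit_bits_def one_bits_def zero_bits_def half_bits_def bits_val_replicate)

lemma weight_correct_literal:
  assumes "finite A" "card A \<le> n" "a \<in> A" "\<not> (fst (pol a) \<and> snd (pol a))"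
  shows "bits_val (fst (weight n pol (Atom a))) = 2 ^ (n - card A) * card (models pol A (Atom a))"
    and "bits_val (fst (weight n pol (Neg (Atom a)))) = 2 ^ (n - card A) * card (models pol A (Neg (Atom a)))"
proof -
  have cA: "0 < card A" using assms card_gt_0_iff by blast
  then have n: "0 < n" using assms(2) by simp
  have full: "2 ^ n = (2::nat) ^ (n - card A) * card (Pow A)"
    using assms by (simp add: card_Pow flip: power_add)
  have P: "{S. S \<subseteq> A} = Pow A" by auto
  have "2 * 2 ^ (n - 1) = (2::nat) ^ n" using n by (cases n) auto
  \<comment> \<open>A free atom holds in half of the subsets, and so does its negation;
    \<open>c\<close> is this number.\<close>
  then have half: "2 ^ (n - 1) = (2::nat) ^ (n - card A) * c" if "2 * c = 2 ^ card A" for c :: nat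
    using that full assms(1) by (simp add: card_Pow) (metis mult.left_commute mult_cancel1 zero_neq_numeral)
  note h = half[OF card_subsets_containing(1)[OF assms(1,3)]] half[OF card_subsets_containing(2)[OF assms(1,3)]]
  show "bits_val (fst (weight n pol (Atom a))) = 2 ^ (n - card A) * card (models pol A (Atom a))"
    using assms(4) h full n by (auto simp: bits_val_lit_bits models_def val_of_def P)
  show "bits_val (fst (weight n pol (Neg (Atom a)))) = 2 ^ (n - card A) * card (models pol A (Neg (Atom a)))"
    using assms(4) h full n by (auto simp: bits_val_lit_bits models_def val_of_def P)
qed

text \<open>The value is \<open>2 ^ n\<close> times the fraction of subsets of \<open>A\<close> that
  are models: \<open>2 ^ (n - card A)\<close> rescales from \<open>card A\<close> to
  \<open>n\<close> fractional bits.\<close>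

lemma weight_correct:
  assumes "finite A" "card A \<le> n" "0 < n" "\<And>a. a \<in> A \<Longrightarrow> \<not> (fst (pol a) \<and> snd (pol a))"
  shows "struct_d_DNNF f \<Longrightarrow> atoms f \<subseteq> A \<Longrightarrow>
    length (fst (weight n pol f)) = Suc n \<and>
    bits_val (fst (weight n pol f)) = 2 ^ (n - card A) * card (models pol A f)"
proof (induction f)
  case (Atom a)
  then show ?case using weight_correct_literal(1)[OF assms(1,2)] assms by (simp add: length_lit_bits)
next
  case (Neg f)
  then obtain a where "f = Atom a" by auto
  then show ?case using weight_correct_literal(2)[OF assms(1,2), of a] Neg assms by (simp add: length_lit_bits)
next
  case (And fs)
  \<comment> \<open>No weight exceeds half the capacity of \<open>n + 1\<close> bits, as
    \<open>bits_val_mul\<close> demands.\<close>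
  have le: "2 ^ (n - card A) * card (models pol A f) \<le> 2 ^ n" for f
    using mult_le_mono2[OF card_models_le[OF assms(1), of pol f], of "2 ^ (n - card A)"] assms(2)
    by (simp flip: power_add)
  have n2: "(2::nat) ^ n = 2 ^ (n - card A) * 2 ^ card A" using assms(2) by (simp flip: power_add)
  let ?p = "\<lambda>gs. foldr (mul []) (map (\<lambda>f. fst (weight n pol f)) gs) (one_bits n)"
  \<comment> \<open>The fold runs from the right, so the claim is generalised to lists that include
    the suffixes of \<open>fs\<close>.\<close>
  have "length (?p gs) = Suc n \<and> bits_val (?p gs) = 2 ^ (n - card A) * card (models pol A (And gs))"
    if "set gs \<subseteq> set fs" "sorted_wrt (\<lambda>f g. atoms f \<inter> atoms g = {}) gs" for gs
    using that
  proof (induction gs)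
    case Nil
    have "models pol A (And []) = Pow A" by (auto simp: models_def)
    then show ?case using assms n2 by (simp add: one_bits_def bits_val_replicate card_Pow)
  next
    case (Cons g gs)
    let ?w = "fst (weight n pol g)" and ?k = "2 ^ (n - card A) :: nat"
    have IH: "length (?p gs) = Suc n" "bits_val (?p gs) = ?k * card (models pol A (And gs))"
      using Cons by auto
    have g: "length ?w = Suc n" "bits_val ?w = ?k * card (models pol A g)"
      using And Cons.prems by auto
    have "bits_val (mul [] ?w (?p gs)) = (bits_val [] + bits_val ?w * bits_val (?p gs)) div 2 ^ (length (?p gs) - 1)"
      by (rule bits_val_mul) (use IH g le[of g] in auto)
    also have "\<dots> = (?k * ?k * (card (models pol A g) * card (models pol A (And gs)))) div 2 ^ n"
      using IH g by (simp add: ac_simps)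
    also have "card (models pol A g) * card (models pol A (And gs)) = 2 ^ card A * card (models pol A (And (g # gs)))"
      using card_models_And_Cons[OF assms(1)] Cons.prems by simp
    \<comment> \<open>One \<open>?k\<close> combines with \<open>2 ^ card A\<close> to
      \<open>2 ^ n\<close>, so the division is exact.\<close>
    also have "?k * ?k * (2 ^ card A * card (models pol A (And (g # gs)))) = 2 ^ n * (?k * card (models pol A (And (g # gs))))"
      unfolding n2 by (simp add: ac_simps)
    finally show ?case using g by simp
  qed
  then show ?case using And by simp
next
  case (Or fs)
  have le: "2 ^ (n - card A) * card (models pol A f) \<le> 2 ^ n" for f
    using mult_le_mono2[OF card_models_le[OF assms(1), of pol f], of "2 ^ (n - card A)"] assms(2)
    by (simp flip: power_add)
  let ?p = "\<lambda>gs. foldr (add False True) (map (\<lambda>f. fst (weight n pol f)) gs) (zero_bits n)"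
  have "length (?p gs) = Suc n \<and> bits_val (?p gs) = 2 ^ (n - card A) * card (models pol A (Or gs))"
    if "set gs \<subseteq> set fs" "sorted_wrt prop_inconsistent gs" for gs
    using that
  proof (induction gs)
    case Nil
    then show ?case by (simp add: zero_bits_def bits_val_replicate models_def)
  next
    case (Cons g gs)
    let ?w = "fst (weight n pol g)" and ?k = "2 ^ (n - card A) :: nat"
    have IH: "length (?p gs) = Suc n" "bits_val (?p gs) = ?k * card (models pol A (Or gs))"
      using Cons by auto
    have g: "length ?w = Suc n" "bits_val ?w = ?k * card (models pol A g)"
      using Or Cons.prems by auto
    have s: "?k * card (models pol A (Or (g # gs))) = ?k * card (models pol A g) + ?k * card (models pol A (Or gs))"
      using card_models_Or_Cons[OF assms(1)] Cons.prems by (simp add: distrib_left)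
    \<comment> \<open>The sum is again a weight of a formula, so the truncation in
      \<open>add\<close> is harmless.\<close>
    have "?k * card (models pol A (Or (g # gs))) < 2 ^ Suc n"
      using le[of "Or (g # gs)"] by (simp add: le_less_trans)
    then show ?case using IH g s by (simp add: bits_val_add)
  qed
  then show ?case using Or by simp
qed

section \<open>Entailment by a cube\<close>

text \<open>The signs with which the atom numbered \<open>k\<close> occurs; on a cube, its literals.
  Conjunction and disjunction are treated alike, so the program need not tell them apart
  here.\<close>

fun polarity :: "('a \<Rightarrow> nat) \<Rightarrow> nat \<Rightarrow> 'a fm \<Rightarrow> bool \<times> bool" where
  "polarity num k (Atom a) = (num a = k, False)"
| "polarity num k (Neg f) = prod.swap (polarity num k f)"
| "polarity num k (And fs) = (\<exists>f\<in>set fs. fst (polarity num k f), \<exists>f\<in>set fs. snd (polarity num k f))"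
| "polarity num k (Or fs) = (\<exists>f\<in>set fs. fst (polarity num k f), \<exists>f\<in>set fs. snd (polarity num k f))"

lemma polarity_in_atoms: "fst (polarity num k f) \<or> snd (polarity num k f) \<Longrightarrow> k \<in> num ` atoms f"
  by (induction f) (force simp: image_iff)+

text \<open>\<open>polarity\<close> sees only numbers; injectivity turns equal numbers back into
  equal atoms.\<close>

lemma holds_literal_iff:
  assumes "is_literal f" "inj_on num B" "atoms f \<subseteq> B"
  shows "holds v f \<longleftrightarrow> (\<forall>a\<in>B. (fst (polarity num (num a) f) \<longrightarrow> v a) \<and> (snd (polarity num (num a) f) \<longrightarrow> \<not> v a))"
  using assms by (auto simp: is_literal_def dest: inj_onD)

lemma holds_cube_iff:
  assumes "is_cube f" "inj_on num B" "atoms f \<subseteq> B"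
  shows "holds v f \<longleftrightarrow> (\<forall>a\<in>B. (fst (polarity num (num a) f) \<longrightarrow> v a) \<and> (snd (polarity num (num a) f) \<longrightarrow> \<not> v a))"
proof (cases "is_literal f")
  case True
  then show ?thesis using holds_literal_iff assms by blast
next
  case False
  then obtain ls where f: "f = And ls" and l: "\<forall>l\<in>set ls. is_literal l" using assms by (auto simp: is_cube_def)
  have "holds v f \<longleftrightarrow> (\<forall>l\<in>set ls. \<forall>a\<in>B. (fst (polarity num (num a) l) \<longrightarrow> v a) \<and> (snd (polarity num (num a) l) \<longrightarrow> \<not> v a))"
    unfolding f holds.simps
    by (rule ball_cong[OF refl], rule holds_literal_iff) (use f l assms in auto)
  then show ?thesis unfolding f by auto
qed

lemma prop_entails_iff_weight:
  fixes num :: "'a \<Rightarrow> nat"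
  defines "pol g \<equiv> (\<lambda>a. polarity num (num a) g)"
  assumes f: "struct_d_DNNF f" "finite (atoms f)" "card (atoms f) \<le> n" "0 < n"
    and g: "is_cube g" and inj: "inj_on num (atoms f \<union> atoms g)"
  shows "prop_entails g f \<longleftrightarrow>
    (\<exists>a\<in>atoms g. fst (pol g a) \<and> snd (pol g a)) \<or> last (fst (weight n (pol g) f))"
proof -
  note cube = holds_cube_iff[OF g inj Un_upper2]
  \<comment> \<open>A cube with complementary literals has no model.\<close>
  have "prop_entails g f" if "a \<in> atoms g" "fst (pol g a)" "snd (pol g a)" for a
    using that cube unfolding prop_entails_def pol_def by blast
  moreover have "prop_entails g f \<longleftrightarrow> last (fst (weight n (pol g) f))"
    if cons: "\<forall>a\<in>atoms g. \<not> (fst (pol g a) \<and> snd (pol g a))"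
  proof -
    let ?A = "atoms f"
    \<comment> \<open>An atom of \<open>f\<close> that is absent from \<open>g\<close> has no sign
      in \<open>g\<close>, by injectivity of \<open>num\<close>.\<close>
    have cons': "\<not> (fst (pol g a) \<and> snd (pol g a))" if "a \<in> atoms f \<union> atoms g" for a
    proof
      assume *: "fst (pol g a) \<and> snd (pol g a)"
      then have "num a \<in> num ` atoms g" using polarity_in_atoms unfolding pol_def by metis
      then have "a \<in> atoms g" using inj that by (auto dest: inj_onD)
      with * cons show False by blast
    qed
    then have w: "length (fst (weight n (pol g) f)) = Suc n"
      "bits_val (fst (weight n (pol g) f)) = 2 ^ (n - card ?A) * card (models (pol g) ?A f)"
      using weight_correct[OF f(2,3,4), of "pol g" f] f(1) by auto
    have "last (fst (weight n (pol g) f)) \<longleftrightarrow> 2 ^ n \<le> 2 ^ (n - card ?A) * card (models (pol g) ?A f)"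
      using w last_bit_iff[of "fst (weight n (pol g) f)"] by (metis diff_Suc_1 length_0_conv nat.distinct(1))
    also have "\<dots> \<longleftrightarrow> 2 ^ card ?A \<le> card (models (pol g) ?A f)"
    proof -
      have "(2::nat) ^ n = 2 ^ (n - card ?A) * 2 ^ card ?A" using f(3) by (simp flip: power_add)
      then show ?thesis by simp
    qed
    also have "\<dots> \<longleftrightarrow> models (pol g) ?A f = Pow ?A"
      using card_models_le[OF f(2), of "pol g" f] card_Pow[OF f(2)]
      by (metis card_subset_eq f(2) finite_Pow_iff le_antisym models_subset order_refl)
    also have "\<dots> \<longleftrightarrow> prop_entails g f"
    proof
      assume m: "models (pol g) ?A f = Pow ?A"
      show "prop_entails g f" unfolding prop_entails_def
      proof (intro allI impI)
        fix v assume v: "holds v g"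
        \<comment> \<open>The subset that reproduces \<open>v\<close>: overriding it by the cube
          changes nothing, because \<open>v\<close> satisfies the cube.\<close>
        have "{a \<in> ?A. v a} \<in> models (pol g) ?A f" unfolding m by auto
        then have "holds (val_of (pol g) {a \<in> ?A. v a}) f" by (simp add: models_def)
        moreover have "holds (val_of (pol g) {a \<in> ?A. v a}) f = holds v f"
          by (rule holds_cong) (use v[unfolded cube] in \<open>auto simp: val_of_def pol_def\<close>)
        ultimately show "holds v f" by simp
      qed
    next
      assume e: "prop_entails g f"
      \<comment> \<open>The override makes every literal of a consistent cube true.\<close>
      have "holds (val_of (pol g) S) g" for S
        unfolding cube val_of_def using cons' unfolding pol_def by blast
      then show "models (pol g) ?A f = Pow ?A"
        using e by (auto simp: models_def prop_entails_def)
    qed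
    finally show ?thesis by simp
  qed
  ultimately show ?thesis by blast
qed

section \<open>Evaluation with a time bound\<close>

text \<open>\<open>eval\<close> fixes exact step counts; upper bounds compose without tracking which
  branch was taken.\<close>

definition runs :: "program \<Rightarrow> tree list \<Rightarrow> expr \<Rightarrow> tree \<Rightarrow> nat \<Rightarrow> bool" where
  "runs P env e v n \<longleftrightarrow> (\<exists>k\<le>n. eval P env e v k)"

definition runs_list :: "program \<Rightarrow> tree list \<Rightarrow> expr list \<Rightarrow> tree list \<Rightarrow> nat \<Rightarrow> bool" where
  "runs_list P env es vs n \<longleftrightarrow> (\<exists>k\<le>n. evals P env es vs k)"

definition call :: "program \<Rightarrow> nat \<Rightarrow> tree list \<Rightarrow> tree \<Rightarrow> nat \<Rightarrow> bool" where
  "call P g us w n \<longleftrightarrow> g < length P \<and> runs P us (P ! g) w n"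

lemma runs_weaken: "runs P env e u k \<Longrightarrow> u = v \<Longrightarrow> k \<le> n \<Longrightarrow> runs P env e v n"
  by (auto simp: runs_def intro: order_trans)

lemma call_weaken: "call P g us u k \<Longrightarrow> u = v \<Longrightarrow> k \<le> n \<Longrightarrow> call P g us v n"
  by (auto simp: call_def intro: runs_weaken)

lemma runs_Arg: "i < length env \<Longrightarrow> runs P env (Arg i) (env ! i) 1"
  unfolding runs_def using eval_Arg by blast

lemma runs_Args:
  "runs P (a # env) (Arg 0) a 1"
  "runs P (a # b # env) (Arg 1) b 1"
  "runs P (a # b # c # env) (Arg 2) c 1"
  "runs P (a # b # c # d # env) (Arg 3) d 1"
  using runs_Arg[of 0 "a # env"] runs_Arg[of 1 "a # b # env"] runs_Arg[of 2 "a # b # c # env"]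
    runs_Arg[of 3 "a # b # c # d # env"] by simp_all

lemma runs_Lf: "runs P env ELf Lf 1"
  unfolding runs_def using eval_Lf by blast

lemma runs_Br: "runs P env e u k \<Longrightarrow> runs P env e' u' k' \<Longrightarrow> runs P env (EBr e e') (Br u u') (Suc (k + k'))"
  unfolding runs_def by (metis Suc_le_mono add_mono eval_Br)

lemma runs_Left: "runs P env e u k \<Longrightarrow> left u = w \<Longrightarrow> runs P env (ELeft e) w (Suc k)"
  unfolding runs_def by (metis Suc_le_mono eval_Left)

lemma runs_Right: "runs P env e u k \<Longrightarrow> right u = w \<Longrightarrow> runs P env (ERight e) w (Suc k)"
  unfolding runs_def by (metis Suc_le_mono eval_Right)

lemma runs_If:
  assumes "runs P env e u k" "runs P env (if u = Lf then e2 else e1) w k'"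
  shows "runs P env (EIf e e1 e2) w (Suc (k + k'))"
proof -
  obtain j j' where "eval P env e u j" "eval P env (if u = Lf then e2 else e1) w j'" "j \<le> k" "j' \<le> k'"
    using assms by (auto simp: runs_def)
  then have "eval P env (EIf e e1 e2) w (Suc (j + j'))"
    by (cases "u = Lf") (auto intro: eval_If_Br eval_If_Lf)
  then show ?thesis using \<open>j \<le> k\<close> \<open>j' \<le> k'\<close> unfolding runs_def
    by (metis Suc_le_mono add_mono)
qed

text \<open>Selects the branch by unification, which needs the value of the condition as a visible
  \<open>Lf\<close> or \<open>Br\<close>. Hence the case splits and unfolded encodings in the proofs
  about the program.\<close>

lemma runs_if_branches:
  "runs P env e2 w k \<Longrightarrow> runs P env (if Lf = Lf then e2 else e1) w k"
  "runs P env e1 w k \<Longrightarrow> runs P env (if Br a b = Lf then e2 else e1) w k"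
  by simp_all

lemma runs_Call: "runs_list P env es us k \<Longrightarrow> call P g us w k' \<Longrightarrow> runs P env (ECall g es) w (Suc (k + k'))"
  unfolding runs_def runs_list_def call_def by (metis Suc_le_mono add_mono eval_Call)

lemma runs_Nil: "runs_list P env [] [] 0"
  unfolding runs_list_def using evals_Nil by blast

lemma runs_Cons:
  "runs P env e u k \<Longrightarrow> runs_list P env es us k' \<Longrightarrow> runs_list P env (e # es) (u # us) (k + k')"
  unfolding runs_def runs_list_def by (metis add_mono evals_Cons)

text \<open>Applied repeatedly after \<open>runs_weaken\<close>, these rules execute a body
  symbolically, building result and cost; what remains is to compare both with the claim.\<close>

lemmas runs_intros = runs_Args runs_Lf runs_Br runs_Left runs_Right runs_If runs_if_branches runs_Call
  runs_Nil runs_Cons left.simps right.simps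

section \<open>The program\<close>

text \<open>Function \<open>0\<close> of the program is a variable entry point, and function \<open>1\<close> decides entailment.\<close>

abbreviation ETrue :: expr where "ETrue \<equiv> EBr ELf ELf"

abbreviation "eLast l \<equiv> ECall 2 [l]"
abbreviation "eNth l i \<equiv> ECall 3 [l, i]"
abbreviation "eSnoc l x \<equiv> ECall 4 [l, x]"
abbreviation "eEq i j \<equiv> ECall 5 [i, j]"
abbreviation "eXor a b c \<equiv> ECall 6 [a, b, c]"
abbreviation "eMaj a b c \<equiv> ECall 7 [a, b, c]"
abbreviation "eAdd c y xs zs \<equiv> ECall 8 [c, y, xs, zs]"
abbreviation "eMul acc xs ys \<equiv> ECall 9 [acc, xs, ys]"
abbreviation "ePad ns x \<equiv> ECall 10 [ns, x]"
abbreviation "eAnyLeft is tab \<equiv> ECall 11 [is, tab]"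
abbreviation "eAnyRight is tab \<equiv> ECall 12 [is, tab]"
abbreviation "ePolNode x tab k d \<equiv> ECall 13 [x, tab, k, d]"
abbreviation "ePolTable ns tab k d \<equiv> ECall 14 [ns, tab, k, d]"
abbreviation "ePol k ns \<equiv> eLast (ePolTable ns ELf k ELf)"
abbreviation "eClash ms ns \<equiv> ECall 15 [ms, ns]"
abbreviation "eLit p q ns \<equiv> ECall 16 [p, q, ns]"
abbreviation "eSum is tab ns \<equiv> ECall 17 [is, tab, ns]"
abbreviation "eProd is tab ns \<equiv> ECall 18 [is, tab, ns]"
abbreviation "eWtNode x tab ns ms \<equiv> ECall 19 [x, tab, ns, ms]"
abbreviation "eWtTable xs tab ns ms \<equiv> ECall 20 [xs, tab, ns, ms]"

definition last_body :: expr where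
  "last_body = EIf (ERight (Arg 0)) (eLast (ERight (Arg 0))) (ELeft (Arg 0))"

definition nth_body :: expr where
  "nth_body = EIf (Arg 1) (eNth (ERight (Arg 0)) (ERight (Arg 1))) (ELeft (Arg 0))"

definition snoc_body :: expr where
  "snoc_body = EIf (Arg 0) (EBr (ELeft (Arg 0)) (eSnoc (ERight (Arg 0)) (Arg 1))) (EBr (Arg 1) ELf)"

definition eq_body :: expr where
  "eq_body = EIf (Arg 0) (EIf (Arg 1) (eEq (ERight (Arg 0)) (ERight (Arg 1))) ELf) (EIf (Arg 1) ELf ETrue)"

definition xor_body :: expr where
  "xor_body = EIf (Arg 0) (EIf (Arg 1) (Arg 2) (EIf (Arg 2) ELf ETrue)) (EIf (Arg 1) (EIf (Arg 2) ELf ETrue) (Arg 2))"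

definition maj_body :: expr where
  "maj_body = EIf (Arg 0) (EIf (Arg 1) ETrue (Arg 2)) (EIf (Arg 1) (Arg 2) ELf)"

definition add_body :: expr where
  "add_body = (let x = EIf (Arg 1) (ELeft (Arg 2)) ELf; z = ELeft (Arg 3) in
     EIf (Arg 2)
       (EBr (eXor (Arg 0) x z) (eAdd (eMaj (Arg 0) x z) (Arg 1) (ERight (Arg 2)) (ERight (Arg 3))))
       ELf)"

text \<open>The \<open>let\<close> belongs to the logic and copies \<open>s\<close>, but each branch
  contains it once. For an empty multiplier the projections of the leaf supply a zero bit, matching
  the first clause of \<open>mul\<close>.\<close>

definition mul_body :: expr where
  "mul_body = (let s = eAdd ELf (ELeft (Arg 2)) (Arg 1) (Arg 0) in
     EIf (ERight (Arg 2)) (eMul (ERight s) (Arg 1) (ERight (Arg 2))) s)"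

text \<open>Only the length of the first argument matters: the node list of \<psi> serves as its own
  unary length.\<close>

definition pad_body :: expr where
  "pad_body = EIf (Arg 0) (EBr ELf (ePad (ERight (Arg 0)) (Arg 1))) (Arg 1)"

definition any_left_body :: expr where
  "any_left_body = EIf (Arg 0)
     (EIf (ELeft (eNth (Arg 1) (ELeft (Arg 0)))) ETrue (eAnyLeft (ERight (Arg 0)) (Arg 1))) ELf"

definition any_right_body :: expr where
  "any_right_body = EIf (Arg 0)
     (EIf (ERight (eNth (Arg 1) (ELeft (Arg 0)))) ETrue (eAnyRight (ERight (Arg 0)) (Arg 1))) ELf"

text \<open>Unary tags are tested by peeling successors. The fourth argument is a dummy that gives
  this function the same shape as \<open>wt_node_body\<close>, so that \<open>call_table\<close>
  serves both.\<close>

definition pol_node_body :: expr where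
  "pol_node_body = EIf (ELeft (Arg 0))
     (EIf (ERight (ELeft (Arg 0)))
       (EBr (eAnyLeft (ERight (Arg 0)) (Arg 1)) (eAnyRight (ERight (Arg 0)) (Arg 1)))
       (EBr (ERight (eNth (Arg 1) (ERight (Arg 0)))) (ELeft (eNth (Arg 1) (ERight (Arg 0))))))
     (EBr (eEq (ERight (Arg 0)) (Arg 2)) ELf)"

definition pol_table_body :: expr where
  "pol_table_body = EIf (Arg 0)
     (ePolTable (ERight (Arg 0)) (eSnoc (Arg 1) (ePolNode (ELeft (Arg 0)) (Arg 1) (Arg 2) (Arg 3))) (Arg 2) (Arg 3))
     (Arg 1)"

text \<open>Scans the atom nodes and rebuilds the polarity table for each sign queried, so literals
  are never compared with each other.\<close>

definition clash_body :: expr where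
  "clash_body = EIf (Arg 0)
     (EIf (ELeft (ELeft (Arg 0))) (eClash (ERight (Arg 0)) (Arg 1))
       (EIf (ELeft (ePol (ERight (ELeft (Arg 0))) (Arg 1)))
         (EIf (ERight (ePol (ERight (ELeft (Arg 0))) (Arg 1))) ETrue (eClash (ERight (Arg 0)) (Arg 1)))
         (eClash (ERight (Arg 0)) (Arg 1))))
     ELf"

definition lit_body :: expr where
  "lit_body = EIf (Arg 0) (ePad (Arg 2) (EBr ETrue ELf))
     (EIf (Arg 1) (ePad (Arg 2) (EBr ELf ELf)) (ePad (ERight (Arg 2)) (EBr ETrue (EBr ELf ELf))))"

definition sum_body :: expr where
  "sum_body = EIf (Arg 0)
     (eAdd ELf ETrue (ELeft (eNth (Arg 1) (ELeft (Arg 0)))) (eSum (ERight (Arg 0)) (Arg 1) (Arg 2)))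
     (ePad (Arg 2) (EBr ELf ELf))"

definition prod_body :: expr where
  "prod_body = EIf (Arg 0)
     (eMul ELf (ELeft (eNth (Arg 1) (ELeft (Arg 0)))) (eProd (ERight (Arg 0)) (Arg 1) (Arg 2)))
     (ePad (Arg 2) (EBr ETrue ELf))"

definition wt_node_body :: expr where
  "wt_node_body = (let t = ELeft (Arg 0); b = ERight (Arg 0) in
     EIf t
       (EIf (ERight t)
         (EIf (ERight (ERight t))
           (EBr (eSum b (Arg 1) (Arg 2)) ELf)
           (EBr (eProd b (Arg 1) (Arg 2)) ELf))
         (EBr (ERight (eNth (Arg 1) b)) (ELeft (eNth (Arg 1) b))))
       (EBr (eLit (ELeft (ePol b (Arg 3))) (ERight (ePol b (Arg 3))) (Arg 2))
            (eLit (ERight (ePol b (Arg 3))) (ELeft (ePol b (Arg 3))) (Arg 2))))"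

definition wt_table_body :: expr where
  "wt_table_body = EIf (Arg 0)
     (eWtTable (ERight (Arg 0)) (eSnoc (Arg 1) (eWtNode (ELeft (Arg 0)) (Arg 1) (Arg 2) (Arg 3))) (Arg 2) (Arg 3))
     (Arg 1)"

text \<open>The inner \<open>eLast\<close> picks the entry of the root, \<open>ELeft\<close> its
  weight, the outer \<open>eLast\<close> the top bit.\<close>

definition entails_body :: expr where
  "entails_body = EIf (eClash (Arg 1) (Arg 1)) ETrue
     (eLast (ELeft (eLast (eWtTable (Arg 0) ELf (Arg 0) (Arg 1)))))"

definition prog :: "expr \<Rightarrow> program" where
  "prog e = [e, entails_body, last_body, nth_body, snoc_body, eq_body, xor_body, maj_body, add_body,
     mul_body, pad_body, any_left_body, any_right_body, pol_node_body, pol_table_body, clash_body,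
     lit_body, sum_body, prod_body, wt_node_body, wt_table_body]"

lemma call_prog:
  "call (prog e) 1 us w n = runs (prog e) us entails_body w n"
  "call (prog e) 2 us w n = runs (prog e) us last_body w n"
  "call (prog e) 3 us w n = runs (prog e) us nth_body w n"
  "call (prog e) 4 us w n = runs (prog e) us snoc_body w n"
  "call (prog e) 5 us w n = runs (prog e) us eq_body w n"
  "call (prog e) 6 us w n = runs (prog e) us xor_body w n"
  "call (prog e) 7 us w n = runs (prog e) us maj_body w n"
  "call (prog e) 8 us w n = runs (prog e) us add_body w n"
  "call (prog e) 9 us w n = runs (prog e) us mul_body w n"
  "call (prog e) 10 us w n = runs (prog e) us pad_body w n"
  "call (prog e) 11 us w n = runs (prog e) us any_left_body w n"
  "call (prog e) 12 us w n = runs (prog e) us any_right_body w n"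
  "call (prog e) 13 us w n = runs (prog e) us pol_node_body w n"
  "call (prog e) 14 us w n = runs (prog e) us pol_table_body w n"
  "call (prog e) 15 us w n = runs (prog e) us clash_body w n"
  "call (prog e) 16 us w n = runs (prog e) us lit_body w n"
  "call (prog e) 17 us w n = runs (prog e) us sum_body w n"
  "call (prog e) 18 us w n = runs (prog e) us prod_body w n"
  "call (prog e) 19 us w n = runs (prog e) us wt_node_body w n"
  "call (prog e) 20 us w n = runs (prog e) us wt_table_body w n"
  unfolding call_def by (simp_all add: prog_def)

section \<open>Correctness and running time\<close>

definition enc_bool :: "bool \<Rightarrow> tree" where
  "enc_bool b = (if b then Br Lf Lf else Lf)"

definition enc_bits :: "bool list \<Rightarrow> tree" where
  "enc_bits xs = enc_list (map enc_bool xs)"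

lemma enc_bool_simps [simp]: "enc_bool True = Br Lf Lf" "enc_bool False = Lf"
  by (simp_all add: enc_bool_def)

lemma enc_list_simps [simp]: "enc_list [] = Lf" "enc_list (u # us) = Br u (enc_list us)"
  by (simp_all add: enc_list_def)

lemma enc_bits_simps [simp]: "enc_bits [] = Lf" "enc_bits (x # xs) = Br (enc_bool x) (enc_bits xs)"
  by (simp_all add: enc_bits_def)

text \<open>Factors such as 10 are generous bounds for one round of the recursion.\<close>

lemma call_last: "us \<noteq> [] \<Longrightarrow> call (prog e) 2 [enc_list us] (last us) (10 * length us)"
proof (induction us)
  case (Cons u us)
  show ?case
  proof (cases us)
    case Nil
    show ?thesis unfolding Nil enc_list_simps call_prog last_body_def
      by (rule runs_weaken, (rule runs_intros)+) simp_all
  next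
    case (Cons v vs)
    have IH: "call (prog e) 2 [Br v (enc_list vs)] (last us) (10 * length us)"
      using Cons.IH Cons by simp
    show ?thesis unfolding Cons enc_list_simps call_prog last_body_def
      by (rule runs_weaken, (rule runs_intros IH)+) (simp_all add: Cons)
  qed
qed simp

lemma call_nth: "i < length us \<Longrightarrow> call (prog e) 3 [enc_list us, enc_nat i] (us ! i) (10 * Suc i)"
proof (induction us arbitrary: i)
  case (Cons u us)
  show ?case
  proof (cases i)
    case 0
    show ?thesis unfolding 0 enc_list_simps enc_nat.simps call_prog nth_body_def
      by (rule runs_weaken, (rule runs_intros)+) simp_all
  next
    case (Suc j)
    then have IH: "call (prog e) 3 [enc_list us, enc_nat j] (us ! j) (10 * Suc j)"
      using Cons by simp
    show ?thesis unfolding Suc enc_list_simps enc_nat.simps call_prog nth_body_def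
      by (rule runs_weaken, (rule runs_intros IH)+) simp_all
  qed
qed simp

lemma call_snoc: "call (prog e) 4 [enc_list us, v] (enc_list (us @ [v])) (10 * Suc (length us))"
proof (induction us)
  case Nil
  show ?case unfolding enc_list_simps call_prog snoc_body_def
    by (rule runs_weaken, (rule runs_intros)+) simp_all
next
  case (Cons u us)
  show ?case unfolding enc_list_simps call_prog snoc_body_def
    by (rule runs_weaken, (rule runs_intros Cons.IH)+) simp_all
qed

lemma call_eq: "call (prog e) 5 [enc_nat i, enc_nat j] (enc_bool (i = j)) (10 * Suc j)"
proof (induction i arbitrary: j)
  case 0
  show ?case
    by (cases j; simp only: enc_nat.simps call_prog eq_body_def;
        rule runs_weaken, (rule runs_intros)+; simp)
next
  case (Suc i)
  show ?case
  proof (cases j)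
    case 0
    show ?thesis unfolding 0 enc_nat.simps call_prog eq_body_def
      by (rule runs_weaken, (rule runs_intros)+) simp_all
  next
    case j: (Suc j')
    show ?thesis unfolding j enc_nat.simps call_prog eq_body_def
      by (rule runs_weaken, (rule runs_intros Suc.IH)+) simp_all
  qed
qed

lemma call_xor: "call (prog e) 6 [enc_bool a, enc_bool b, enc_bool c] (enc_bool (xor3 a b c)) 10"
  by (cases a; cases b; cases c; simp only: enc_bool_simps call_prog xor_body_def;
      rule runs_weaken, (rule runs_intros)+; simp add: xor3_def)

lemma call_maj: "call (prog e) 7 [enc_bool a, enc_bool b, enc_bool c] (enc_bool (maj a b c)) 10"
  by (cases a; cases b; cases c; simp only: enc_bool_simps call_prog maj_body_def;
      rule runs_weaken, (rule runs_intros)+; simp add: maj_def)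

lemma call_add:
  "call (prog e) 8 [enc_bool c, enc_bool y, enc_bits xs, enc_bits zs] (enc_bits (add c y xs zs))
     (60 * Suc (length xs))"
proof (induction c y xs zs rule: add.induct)
  case (1 c y zs)
  show ?case unfolding enc_bits_simps call_prog add_body_def Let_def
    by (rule runs_weaken, (rule runs_intros)+) simp_all
next
  case (2 c y x xs zs)
  define z where "z = (zs \<noteq> [] \<and> hd zs)"
  note IH = 2[folded z_def]
  \<comment> \<open>Projections of a leaf are leaves, so an exhausted \<open>zs\<close> goes on
    supplying zero bits.\<close>
  have l: "left (enc_bits zs) = enc_bool z" and r: "right (enc_bits zs) = enc_bits (tl zs)"
    by (cases zs; simp add: z_def)+
  show ?case
  proof (cases y)
    case True
    note X = call_xor[of e c x z] and M = call_maj[of e c x z]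
    have IH': "call (prog e) 8 [enc_bool (maj c x z), Br Lf Lf, enc_bits xs, enc_bits (tl zs)]
       (enc_bits (add (maj c x z) y xs (tl zs))) (60 * Suc (length xs))"
      using IH True by simp
    have y: "y = True" using True by simp
    show ?thesis unfolding y enc_bits_simps enc_bool_simps call_prog add_body_def Let_def
      by (rule runs_weaken, (rule l r X M IH' runs_intros)+) (simp_all add: z_def True)
  next
    case False
    note X = call_xor[of e c False z, unfolded enc_bool_simps]
      and M = call_maj[of e c False z, unfolded enc_bool_simps]
    have IH': "call (prog e) 8 [enc_bool (maj c False z), Lf, enc_bits xs, enc_bits (tl zs)]
       (enc_bits (add (maj c False z) y xs (tl zs))) (60 * Suc (length xs))"
      using IH False by simp
    have y: "y = False" using False by simp
    show ?thesis unfolding y enc_bits_simps enc_bool_simps call_prog add_body_def Let_def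
      by (rule runs_weaken, (rule l r X M IH' runs_intros)+) (simp_all add: z_def False)
  qed
qed

lemma call_mul:
  "call (prog e) 9 [enc_bits acc, enc_bits xs, enc_bits ys] (enc_bits (mul acc xs ys))
     (Suc (length ys) * (60 * Suc (length xs) + 30))"
proof (induction acc xs ys rule: mul.induct)
  case (1 acc xs)
  note A = call_add[of e False False xs acc, unfolded enc_bool_simps]
  show ?case unfolding enc_bits_simps call_prog mul_body_def Let_def
    by (rule runs_weaken, (rule A runs_intros)+) simp_all
next
  case (2 acc xs y)
  note A = call_add[of e False y xs acc, unfolded enc_bool_simps]
  show ?case unfolding enc_bits_simps call_prog mul_body_def Let_def
    by (rule runs_weaken, (rule A runs_intros)+) simp_all
next
  case (3 acc xs y y' ys)
  note A = call_add[of e False y xs acc, unfolded enc_bool_simps]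
  have r: "right (enc_bits zs) = enc_bits (tl zs)" for zs by (cases zs) simp_all
  show ?case unfolding enc_bits_simps call_prog mul_body_def Let_def
    by (rule runs_weaken, (rule A r 3[unfolded enc_bits_simps] runs_intros)+) simp_all
qed

lemma call_pad:
  "call (prog e) 10 [enc_list us, enc_bits xs] (enc_bits (replicate (length us) False @ xs)) (10 * Suc (length us))"
proof (induction us)
  case Nil
  show ?case unfolding enc_list_simps call_prog pad_body_def
    by (rule runs_weaken, (rule runs_intros)+) simp_all
next
  case (Cons u us)
  show ?case unfolding enc_list_simps call_prog pad_body_def
    by (rule runs_weaken, (rule runs_intros Cons.IH)+) simp_all
qed

section \<open>Polarity tables and the test for complementary literals\<close>

definition enc_pol :: "bool \<times> bool \<Rightarrow> tree" where
  "enc_pol p = Br (enc_bool (fst p)) (enc_bool (snd p))"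

lemma enc_pol_proj: "left (enc_pol p) = enc_bool (fst p)" "right (enc_pol p) = enc_bool (snd p)"
  by (simp_all add: enc_pol_def)

text \<open>A table is viewed as the image under \<open>r\<close> of the formulas of the nodes
  treated so far, so a child index finds the value of that child.\<close>

lemma call_nth_map:
  "i < length fs \<Longrightarrow> length fs \<le> M \<Longrightarrow> call (prog e) 3 [enc_list (map r fs), enc_nat i] (r (fs ! i)) (10 * M)"
  by (rule call_weaken[OF call_nth]) auto

definition any_cost :: "nat \<Rightarrow> nat" where
  "any_cost M = Suc M * (10 * M + 30)"

lemma call_any_aux:
  assumes "\<forall>i\<in>set is. i < length fs" "length fs \<le> M"
  shows "call (prog e) 11 [enc_list (map enc_nat is), enc_list (map (\<lambda>f. enc_pol (h f)) fs)]
      (enc_bool (\<exists>i\<in>set is. fst (h (fs ! i)))) (Suc (length is) * (10 * M + 30))"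
    and "call (prog e) 12 [enc_list (map enc_nat is), enc_list (map (\<lambda>f. enc_pol (h f)) fs)]
      (enc_bool (\<exists>i\<in>set is. snd (h (fs ! i)))) (Suc (length is) * (10 * M + 30))"
  using assms(1)
proof (induction "is")
  case Nil
  {
    case 1
    show ?case unfolding list.map enc_list_simps call_prog any_left_body_def
      by (rule runs_weaken, (rule runs_intros)+) simp_all
  next
    case 2
    show ?case unfolding list.map enc_list_simps call_prog any_right_body_def
      by (rule runs_weaken, (rule runs_intros)+) simp_all
  }
next
  case (Cons i "is")
  have N: "call (prog e) 3 [enc_list (map (\<lambda>f. enc_pol (h f)) fs), enc_nat i] (enc_pol (h (fs ! i))) (10 * M)"
    if "i < length fs" using call_nth_map[OF that assms(2), of e "\<lambda>f. enc_pol (h f)"] .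
  {
    case 1
    then have N': "call (prog e) 3 [enc_list (map (\<lambda>f. enc_pol (h f)) fs), enc_nat i] (enc_pol (h (fs ! i))) (10 * M)"
      and IH: "call (prog e) 11 [enc_list (map enc_nat is), enc_list (map (\<lambda>f. enc_pol (h f)) fs)]
      (enc_bool (\<exists>i\<in>set is. fst (h (fs ! i)))) (Suc (length is) * (10 * M + 30))"
      using N Cons.IH(1) by simp_all
    show ?case
    proof (cases "fst (h (fs ! i))")
      case True
      then have l: "left (enc_pol (h (fs ! i))) = Br Lf Lf" by (simp add: enc_pol_def)
      show ?thesis unfolding list.map enc_list_simps call_prog any_left_body_def
        by (rule runs_weaken, (rule l N' runs_intros)+) (simp_all add: True)
    next
      case False
      then have l: "left (enc_pol (h (fs ! i))) = Lf" by (simp add: enc_pol_def)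
      show ?thesis unfolding list.map enc_list_simps call_prog any_left_body_def
        by (rule runs_weaken, (rule l N' IH runs_intros)+) (simp_all add: False)
    qed
  next
    case 2
    then have N': "call (prog e) 3 [enc_list (map (\<lambda>f. enc_pol (h f)) fs), enc_nat i] (enc_pol (h (fs ! i))) (10 * M)"
      and IH: "call (prog e) 12 [enc_list (map enc_nat is), enc_list (map (\<lambda>f. enc_pol (h f)) fs)]
      (enc_bool (\<exists>i\<in>set is. snd (h (fs ! i)))) (Suc (length is) * (10 * M + 30))"
      using N Cons.IH(2) by simp_all
    show ?case
    proof (cases "snd (h (fs ! i))")
      case True
      then have l: "right (enc_pol (h (fs ! i))) = Br Lf Lf" by (simp add: enc_pol_def)
      show ?thesis unfolding list.map enc_list_simps call_prog any_right_body_def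
        by (rule runs_weaken, (rule l N' runs_intros)+) (simp_all add: True)
    next
      case False
      then have l: "right (enc_pol (h (fs ! i))) = Lf" by (simp add: enc_pol_def)
      show ?thesis unfolding list.map enc_list_simps call_prog any_right_body_def
        by (rule runs_weaken, (rule l N' IH runs_intros)+) (simp_all add: False)
    qed
  }
qed

lemma call_any:
  assumes "\<forall>i\<in>set is. i < length fs" "length fs \<le> M" "length is \<le> M"
  shows "call (prog e) 11 [enc_list (map enc_nat is), enc_list (map (\<lambda>f. enc_pol (h f)) fs)]
      (enc_bool (\<exists>i\<in>set is. fst (h (fs ! i)))) (any_cost M)"
    and "call (prog e) 12 [enc_list (map enc_nat is), enc_list (map (\<lambda>f. enc_pol (h f)) fs)]
      (enc_bool (\<exists>i\<in>set is. snd (h (fs ! i)))) (any_cost M)"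
  by (rule call_weaken[OF call_any_aux(1)[OF assms(1,2)] refl] call_weaken[OF call_any_aux(2)[OF assms(1,2)] refl];
      unfold any_cost_def; intro mult_le_mono1; use assms(3) in simp)+

lemma enc_node_simps:
  "enc_node num (NAtom a) = Br Lf (enc_nat (num a))"
  "enc_node num (NNot i) = Br (Br Lf Lf) (enc_nat i)"
  "enc_node num (NAnd is) = Br (Br Lf (Br Lf Lf)) (enc_list (map enc_nat is))"
  "enc_node num (NOr is) = Br (Br Lf (Br Lf (Br Lf Lf))) (enc_list (map enc_nat is))"
  by (simp_all add: numeral_eq_Suc)

definition pol_node_cost :: "nat \<Rightarrow> nat" where
  "pol_node_cost M = 2 * any_cost M + 40 * M + 40"

lemma call_pol_node:
  assumes c: "\<forall>c\<in>set (children x). c < length fs" and M: "length fs \<le> M" "length (children x) \<le> M" "k < M"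
  shows "call (prog e) 13 [enc_node num x, enc_list (map (\<lambda>f. enc_pol (polarity num k f)) fs), enc_nat k, d]
    (enc_pol (polarity num k (node_fm fs x))) (pol_node_cost M)"
proof (cases x)
  case (NAtom a)
  show ?thesis unfolding NAtom enc_node_simps call_prog pol_node_body_def
    by (rule runs_weaken, (rule call_eq runs_intros)+)
      (use M in \<open>simp_all add: enc_pol_def pol_node_cost_def\<close>)
next
  case (NNot i)
  then have N: "call (prog e) 3 [enc_list (map (\<lambda>f. enc_pol (polarity num k f)) fs), enc_nat i]
      (enc_pol (polarity num k (fs ! i))) (10 * M)"
    using call_nth_map[OF _ M(1), of i e "\<lambda>f. enc_pol (polarity num k f)"] c by simp
  show ?thesis unfolding NNot enc_node_simps call_prog pol_node_body_def
    by (rule runs_weaken, (rule N enc_pol_proj runs_intros)+)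
      (use M in \<open>simp_all add: enc_pol_def pol_node_cost_def\<close>)
next
  case (NAnd "is")
  then have A: "\<forall>i\<in>set is. i < length fs" "length is \<le> M" using c M by simp_all
  note any = call_any[OF A(1) M(1) A(2), of e "polarity num k"]
  show ?thesis unfolding NAnd enc_node_simps call_prog pol_node_body_def
    by (rule runs_weaken, (rule any runs_intros)+)
      (use M in \<open>simp_all add: enc_pol_def pol_node_cost_def\<close>)
next
  case (NOr "is")
  then have A: "\<forall>i\<in>set is. i < length fs" "length is \<le> M" using c M by simp_all
  note any = call_any[OF A(1) M(1) A(2), of e "polarity num k"]
  show ?thesis unfolding NOr enc_node_simps call_prog pol_node_body_def
    by (rule runs_weaken, (rule any runs_intros)+)
      (use M in \<open>simp_all add: enc_pol_def pol_node_cost_def\<close>)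
qed

text \<open>The two table builders differ only in function numbers. If one step computes
  \<open>r\<close> of a node from the entries of its children, the loop mirrors the fold in
  \<open>dag_fms\<close>.\<close>

lemma call_table_aux:
  assumes gh: "(g, h) = (14, 13) \<or> (g, h) = (20, 19)"
    and node: "\<And>x fs. x \<in> X \<Longrightarrow> \<forall>c\<in>set (children x). c < length fs \<Longrightarrow> length fs \<le> M \<Longrightarrow>
      call (prog e) h [enc_node num x, enc_list (map r fs), a, b] (r (node_fm fs x)) C"
  shows "set ms \<subseteq> X \<Longrightarrow> \<forall>i<length ms. \<forall>c\<in>set (children (ms ! i)). c < length fs + i \<Longrightarrow>
    length fs + length ms \<le> M \<Longrightarrow>
    call (prog e) g [enc_dag num ms, enc_list (map r fs), a, b]
      (enc_list (map r (foldl (\<lambda>fs n. fs @ [node_fm fs n]) fs ms))) (Suc (length ms) * (C + 10 * M + 40))"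
proof (induction ms arbitrary: fs)
  case Nil
  from gh show ?case
  proof
    assume "(g, h) = (14, 13)"
    then have e: "g = 14" by auto
    show ?thesis unfolding e enc_dag_def list.map enc_list_simps call_prog pol_table_body_def
      by (rule runs_weaken, (rule runs_intros)+) simp_all
  next
    assume "(g, h) = (20, 19)"
    then have e: "g = 20" by auto
    show ?thesis unfolding e enc_dag_def list.map enc_list_simps call_prog wt_table_body_def
      by (rule runs_weaken, (rule runs_intros)+) simp_all
  qed
next
  case (Cons x ms)
  have x: "\<forall>c\<in>set (children x). c < length fs" using Cons.prems(2) by auto
  have N: "call (prog e) h [enc_node num x, enc_list (map r fs), a, b] (r (node_fm fs x)) C"
    using node[OF _ x] Cons.prems by simp
  have S: "call (prog e) 4 [enc_list (map r fs), r (node_fm fs x)] (enc_list (map r (fs @ [node_fm fs x]))) (10 * M)"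
    by (rule call_weaken[OF call_snoc]) (use Cons.prems in auto)
  \<comment> \<open>Moving one node into the table shifts the remaining positions by one.\<close>
  have "\<forall>c\<in>set (children (ms ! i)). c < length fs + Suc i" if "i < length ms" for i
    using Cons.prems(2)[rule_format, of "Suc i"] that by simp
  then have IH: "call (prog e) g [enc_list (map (enc_node num) ms), enc_list (map r (fs @ [node_fm fs x])), a, b]
      (enc_list (map r (foldl (\<lambda>fs n. fs @ [node_fm fs n]) (fs @ [node_fm fs x]) ms))) (Suc (length ms) * (C + 10 * M + 40))"
    using Cons.IH[of "fs @ [node_fm fs x]"] Cons.prems by (simp add: enc_dag_def)
  from gh show ?case
  proof
    assume "(g, h) = (14, 13)"
    then have e: "g = 14" "h = 13" by auto
    show ?thesis unfolding e enc_dag_def list.map enc_list_simps call_prog pol_table_body_def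
      by (rule runs_weaken, (rule S N[unfolded e] IH[unfolded e] runs_intros)+) simp_all
  next
    assume "(g, h) = (20, 19)"
    then have e: "g = 20" "h = 19" by auto
    show ?thesis unfolding e enc_dag_def list.map enc_list_simps call_prog wt_table_body_def
      by (rule runs_weaken, (rule S N[unfolded e] IH[unfolded e] runs_intros)+) simp_all
  qed
qed

lemma call_table:
  assumes "(g, h) = (14, 13) \<or> (g, h) = (20, 19)" "is_dag ms" "length ms \<le> M"
    and "\<And>x fs. x \<in> set ms \<Longrightarrow> \<forall>c\<in>set (children x). c < length fs \<Longrightarrow> length fs \<le> M \<Longrightarrow>
      call (prog e) h [enc_node num x, enc_list (map r fs), a, b] (r (node_fm fs x)) C"
  shows "call (prog e) g [enc_dag num ms, Lf, a, b] (enc_list (map r (dag_fms ms))) (Suc M * (C + 10 * M + 40))"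
proof -
  have "call (prog e) g [enc_dag num ms, enc_list (map r []), a, b]
      (enc_list (map r (foldl (\<lambda>fs n. fs @ [node_fm fs n]) [] ms))) (Suc (length ms) * (C + 10 * M + 40))"
    by (rule call_table_aux[OF assms(1) assms(4)]) (use assms(2,3) in \<open>auto simp: is_dag_def\<close>)
  then show ?thesis unfolding dag_fms_def
    by (simp only: list.map enc_list_simps, elim call_weaken) (use assms(3) in \<open>auto intro: mult_le_mono1\<close>)
qed

lemma call_last_dag:
  assumes "is_dag ms" "length ms \<le> M"
  shows "call (prog e) 2 [enc_list (map r (dag_fms ms))] (r (dag_fm ms)) (10 * M)"
proof -
  have "dag_fms ms \<noteq> []" using assms by (metis is_dag_def length_0_conv length_dag_fms)
  then show ?thesis
    by (intro call_weaken[OF call_last]) (use assms in \<open>simp_all add: last_map dag_fm_def\<close>)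
qed

definition pol_cost :: "nat \<Rightarrow> nat" where
  "pol_cost M = Suc M * (pol_node_cost M + 10 * M + 40) + 10 * M + 10"

text \<open>\<open>ePol\<close> is an expression pattern, not a function, hence the arbitrary
  argument expressions \<open>ek\<close> and \<open>em\<close>.\<close>

lemma runs_pol:
  assumes "is_dag ms" "length ms \<le> M" "k < M" "runs (prog e) env ek (enc_nat k) c"
    "runs (prog e) env em (enc_dag num ms) c'"
  shows "runs (prog e) env (ePol ek em) (enc_pol (polarity num k (dag_fm ms))) (c + c' + pol_cost M)"
proof -
  have "length (children x) \<le> M" if "x \<in> set ms" for x
    using length_children_le[OF assms(1) that] assms(2) by linarith
  then have T: "call (prog e) 14 [enc_dag num ms, Lf, enc_nat k, Lf]
      (enc_list (map (\<lambda>f. enc_pol (polarity num k f)) (dag_fms ms))) (Suc M * (pol_node_cost M + 10 * M + 40))"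
    using assms by (intro call_table[where h = 13] call_pol_node) simp_all
  show ?thesis
    by (rule runs_weaken, (rule assms(4,5) T call_last_dag[OF assms(1,2), where r = "\<lambda>f. enc_pol (polarity num k f)"] runs_intros)+)
      (simp_all add: pol_cost_def)
qed

definition clash_cost :: "nat \<Rightarrow> nat" where
  "clash_cost M = Suc M * (2 * pol_cost M + 60)"

lemma call_clash_aux:
  assumes "is_dag ns" "length ns \<le> M"
  shows "\<forall>a. NAtom a \<in> set ms \<longrightarrow> num a < M \<Longrightarrow>
    call (prog e) 15 [enc_dag num ms, enc_dag num ns]
      (enc_bool (\<exists>a. NAtom a \<in> set ms \<and> fst (polarity num (num a) (dag_fm ns)) \<and> snd (polarity num (num a) (dag_fm ns))))
      (Suc (length ms) * (2 * pol_cost M + 60))"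
proof (induction ms)
  case Nil
  show ?case unfolding enc_dag_def[of num "[]"] list.map enc_list_simps call_prog clash_body_def
    by (rule runs_weaken, (rule runs_intros)+) simp_all
next
  case (Cons x ms)
  define b where "b \<longleftrightarrow> (\<exists>a. NAtom a \<in> set ms \<and> fst (polarity num (num a) (dag_fm ns)) \<and> snd (polarity num (num a) (dag_fm ns)))"
  have IH: "call (prog e) 15 [enc_list (map (enc_node num) ms), enc_dag num ns] (enc_bool b)
      (Suc (length ms) * (2 * pol_cost M + 60))"
    using Cons by (simp add: enc_dag_def[of num ms] b_def)
  have enc: "enc_dag num (x # ms) = Br (enc_node num x) (enc_list (map (enc_node num) ms))"
    by (simp add: enc_dag_def)
  show ?case
  proof (cases x)
    case (NAtom a)
    then have "num a < M" using Cons.prems by simp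
    note pol = runs_pol[OF assms this]
    let ?p = "polarity num (num a) (dag_fm ns)"
    show ?thesis
    proof (cases "fst ?p")
      case T1: True
      then have l: "left (enc_pol ?p) = Br Lf Lf" by (simp add: enc_pol_def)
      show ?thesis
      proof (cases "snd ?p")
        case True
        then have r: "right (enc_pol ?p) = Br Lf Lf" by (simp add: enc_pol_def)
        show ?thesis unfolding enc unfolding NAtom enc_node_simps call_prog clash_body_def
          by (rule runs_weaken, (rule pol l r runs_intros)+) (use T1 True in \<open>auto simp: enc_bool_def\<close>)
      next
        case False
        then have r: "right (enc_pol ?p) = Lf" by (simp add: enc_pol_def)
        show ?thesis unfolding enc unfolding NAtom enc_node_simps call_prog clash_body_def
          by (rule runs_weaken, (rule pol l r IH runs_intros)+) (use False in \<open>auto simp: b_def intro!: arg_cong[of _ _ enc_bool]\<close>)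
      qed
    next
      case False
      then have l: "left (enc_pol ?p) = Lf" by (simp add: enc_pol_def)
      show ?thesis unfolding enc unfolding NAtom enc_node_simps call_prog clash_body_def
        by (rule runs_weaken, (rule pol l IH runs_intros)+) (use False in \<open>auto simp: b_def intro!: arg_cong[of _ _ enc_bool]\<close>)
    qed
  next
    case (NNot i)
    show ?thesis unfolding enc unfolding NNot enc_node_simps call_prog clash_body_def
      by (rule runs_weaken, (rule IH runs_intros)+) (simp_all add: b_def)
  next
    case (NAnd "is")
    show ?thesis unfolding enc unfolding NAnd enc_node_simps call_prog clash_body_def
      by (rule runs_weaken, (rule IH runs_intros)+) (simp_all add: b_def)
  next
    case (NOr "is")
    show ?thesis unfolding enc unfolding NOr enc_node_simps call_prog clash_body_def
      by (rule runs_weaken, (rule IH runs_intros)+) (simp_all add: b_def)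
  qed
qed

section \<open>Weights computed by the program\<close>

lemma call_lit:
  assumes "us \<noteq> []"
  shows "call (prog e) 16 [enc_bool p, enc_bool q, enc_list us] (enc_bits (lit_bits (length us) p q)) (10 * length us + 40)"
proof -
  obtain u vs where us: "us = u # vs" using assms by (cases us) auto
  note pads = call_pad[of e us "[True]", unfolded enc_bits_simps enc_bool_simps]
    call_pad[of e us "[False]", unfolded enc_bits_simps enc_bool_simps]
    call_pad[of e vs "[True, False]", unfolded enc_bits_simps enc_bool_simps]
  have r: "right (enc_list us) = enc_list vs" by (simp add: us)
  have n: "length us - 1 = length vs" "length us = Suc (length vs)" by (simp_all add: us)
  show ?thesis
    by (cases p; cases q; simp only: enc_bool_simps call_prog lit_body_def;
        rule runs_weaken, (rule pads r runs_intros)+;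
        simp add: lit_bits_def one_bits_def zero_bits_def half_bits_def n del: replicate.simps)
qed

definition enc_wt :: "bool list \<times> bool list \<Rightarrow> tree" where
  "enc_wt w = Br (enc_bits (fst w)) (enc_bits (snd w))"

lemma enc_wt_proj: "left (enc_wt w) = enc_bits (fst w)" "right (enc_wt w) = enc_bits (snd w)"
  by (simp_all add: enc_wt_def)

definition sum_cost :: "nat \<Rightarrow> nat" where
  "sum_cost M = Suc M * (70 * M + 100)"

lemma call_sum:
  assumes "length fs \<le> M" "\<And>f. length (fst (h f)) \<le> M" "length us \<le> M" "length is \<le> M"
    "\<forall>i\<in>set is. i < length fs"
  shows "call (prog e) 17 [enc_list (map enc_nat is), enc_list (map (\<lambda>f. enc_wt (h f)) fs), enc_list us]
      (enc_bits (foldr (add False True) (map (\<lambda>i. fst (h (fs ! i))) is) (zero_bits (length us)))) (sum_cost M)"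
proof -
  have "call (prog e) 17 [enc_list (map enc_nat is), enc_list (map (\<lambda>f. enc_wt (h f)) fs), enc_list us]
      (enc_bits (foldr (add False True) (map (\<lambda>i. fst (h (fs ! i))) is) (zero_bits (length us)))) (Suc (length is) * (70 * M + 100))"
    using assms(5)
  proof (induction "is")
    case Nil
    note pad = call_pad[of e us "[False]", unfolded enc_bits_simps enc_bool_simps]
    show ?case unfolding list.map enc_list_simps call_prog sum_body_def
      by (rule runs_weaken, (rule pad runs_intros)+) (use assms(3) in \<open>simp_all add: zero_bits_def\<close>)
  next
    case (Cons i "is")
    then have N: "call (prog e) 3 [enc_list (map (\<lambda>f. enc_wt (h f)) fs), enc_nat i] (enc_wt (h (fs ! i))) (10 * M)"
      using call_nth_map[OF _ assms(1), of i e "\<lambda>f. enc_wt (h f)"] by simp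
    let ?r = "foldr (add False True) (map (\<lambda>i. fst (h (fs ! i))) is) (zero_bits (length us))"
    have IH: "call (prog e) 17 [enc_list (map enc_nat is), enc_list (map (\<lambda>f. enc_wt (h f)) fs), enc_list us]
      (enc_bits ?r) (Suc (length is) * (70 * M + 100))"
      using Cons by simp
    note A = call_add[of e False True "fst (h (fs ! i))" ?r, unfolded enc_bool_simps]
    show ?case unfolding list.map enc_list_simps call_prog sum_body_def
      by (rule runs_weaken, (rule N IH A enc_wt_proj runs_intros)+) (use assms(2)[of "fs ! i"] in simp_all)
  qed
  then show ?thesis
    by (rule call_weaken) (unfold sum_cost_def, use assms(4) in \<open>auto intro: mult_le_mono1\<close>)
qed

definition prod_cost :: "nat \<Rightarrow> nat" where
  "prod_cost M = Suc M * (Suc M * (60 * Suc M + 30) + 10 * M + 100)"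

text \<open>The strict bound on \<open>us\<close> leaves room for the extra bit of
  \<open>one_bits\<close>, a multiplier whose width enters the cost.\<close>

lemma call_prod:
  assumes "length fs \<le> M" "\<And>f. length (fst (h f)) \<le> M" "length us < M" "length is \<le> M"
    "\<forall>i\<in>set is. i < length fs"
  shows "call (prog e) 18 [enc_list (map enc_nat is), enc_list (map (\<lambda>f. enc_wt (h f)) fs), enc_list us]
      (enc_bits (foldr (mul []) (map (\<lambda>i. fst (h (fs ! i))) is) (one_bits (length us)))) (prod_cost M)"
proof -
  let ?C = "Suc M * (60 * Suc M + 30) + 10 * M + 100"
  have "call (prog e) 18 [enc_list (map enc_nat is), enc_list (map (\<lambda>f. enc_wt (h f)) fs), enc_list us]
      (enc_bits (foldr (mul []) (map (\<lambda>i. fst (h (fs ! i))) is) (one_bits (length us)))) (Suc (length is) * ?C)"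
    using assms(5)
  proof (induction "is")
    case Nil
    note pad = call_pad[of e us "[True]", unfolded enc_bits_simps enc_bool_simps]
    show ?case unfolding list.map enc_list_simps call_prog prod_body_def
      by (rule runs_weaken, (rule pad runs_intros)+) (use assms(3) in \<open>simp_all add: one_bits_def\<close>)
  next
    case (Cons i "is")
    then have N: "call (prog e) 3 [enc_list (map (\<lambda>f. enc_wt (h f)) fs), enc_nat i] (enc_wt (h (fs ! i))) (10 * M)"
      using call_nth_map[OF _ assms(1), of i e "\<lambda>f. enc_wt (h f)"] by simp
    let ?r = "foldr (mul []) (map (\<lambda>i. fst (h (fs ! i))) is) (one_bits (length us))"
    have IH: "call (prog e) 18 [enc_list (map enc_nat is), enc_list (map (\<lambda>f. enc_wt (h f)) fs), enc_list us]
      (enc_bits ?r) (Suc (length is) * ?C)"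
      using Cons by simp
    have "length ?r \<le> M" using assms(2,3) by (cases "is") (simp_all add: one_bits_def)
    then have "Suc (length ?r) * (60 * Suc (length (fst (h (fs ! i)))) + 30) \<le> Suc M * (60 * Suc M + 30)"
      using assms(2)[of "fs ! i"] by (intro mult_le_mono) simp_all
    note A = call_weaken[OF call_mul[of e "[]" "fst (h (fs ! i))" ?r] refl this, unfolded enc_bits_simps]
    \<comment> \<open>Keeping \<open>K\<close> opaque spares the simplifier from multiplying out the
      quadratic cost.\<close>
    have arith: "Suc (Suc a) * (K + 10 * M + 100) = Suc a * (K + 10 * M + 100) + (K + 10 * M + 100)" for a K
      by simp
    show ?case unfolding list.map enc_list_simps call_prog prod_body_def
      by (rule runs_weaken, (rule N IH A enc_wt_proj runs_intros)+) (simp_all only: arith list.size foldr.simps comp_apply add_Suc_right add_0_right)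
  qed
  then show ?thesis
    by (rule call_weaken) (unfold prod_cost_def, use assms(4) in \<open>auto intro: mult_le_mono1\<close>)
qed

definition wt_node_cost :: "nat \<Rightarrow> nat" where
  "wt_node_cost M = sum_cost M + prod_cost M + 4 * pol_cost M + 20 * M + 200"

lemma call_wt_node:
  fixes num :: "'a \<Rightarrow> nat"
  defines "wt n ms \<equiv> weight n (\<lambda>a. polarity num (num a) (dag_fm ms))"
  assumes c: "\<forall>c\<in>set (children x). c < length fs" and M: "length fs \<le> M" "length (children x) \<le> M"
    and num: "\<And>a. x = NAtom a \<Longrightarrow> num a < M" and us: "us \<noteq> []" "length us < M"
    and ms: "is_dag ms" "length ms \<le> M"
  shows "call (prog e) 19 [enc_node num x, enc_list (map (\<lambda>f. enc_wt (wt (length us) ms f)) fs), enc_list us, enc_dag num ms]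
    (enc_wt (wt (length us) ms (node_fm fs x))) (wt_node_cost M)"
proof (cases x)
  case (NAtom a)
  let ?p = "polarity num (num a) (dag_fm ms)"
  note pol = runs_pol[OF ms num[OF NAtom]]
  show ?thesis unfolding NAtom enc_node_simps call_prog wt_node_body_def Let_def
    by (rule runs_weaken, (rule pol enc_pol_proj call_lit[OF us(1)] runs_intros)+)
      (use us in \<open>simp_all add: enc_wt_def wt_def wt_node_cost_def\<close>)
next
  case (NNot i)
  then have N: "call (prog e) 3 [enc_list (map (\<lambda>f. enc_wt (wt (length us) ms f)) fs), enc_nat i]
      (enc_wt (wt (length us) ms (fs ! i))) (10 * M)"
    using call_nth_map[OF _ M(1), of i e "\<lambda>f. enc_wt (wt (length us) ms f)"] c by simp
  show ?thesis unfolding NNot enc_node_simps call_prog wt_node_body_def Let_def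
    by (rule runs_weaken, (rule N enc_wt_proj runs_intros)+)
      (use us in \<open>simp_all add: enc_wt_def wt_def wt_node_cost_def\<close>)
next
  case (NAnd "is")
  then have A: "\<forall>i\<in>set is. i < length fs" "length is \<le> M" using c M by simp_all
  have "length (fst (wt (length us) ms f)) \<le> M" for f
    using length_weight[of "length us" _ f] us unfolding wt_def by (metis Suc_le_eq le_trans length_greater_0_conv)
  note P = call_prod[OF M(1) this us(2) A(2,1)]
  show ?thesis unfolding NAnd enc_node_simps call_prog wt_node_body_def Let_def
    by (rule runs_weaken, (rule P runs_intros)+)
      (simp_all add: enc_wt_def wt_def wt_node_cost_def comp_def)
next
  case (NOr "is")
  then have A: "\<forall>i\<in>set is. i < length fs" "length is \<le> M" using c M by simp_all
  have "length (fst (wt (length us) ms f)) \<le> M" for f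
    using length_weight[of "length us" _ f] us unfolding wt_def by (metis Suc_le_eq le_trans length_greater_0_conv)
  note P = call_sum[OF M(1) this less_imp_le[OF us(2)] A(2,1)]
  show ?thesis unfolding NOr enc_node_simps call_prog wt_node_body_def Let_def
    by (rule runs_weaken, (rule P runs_intros)+)
      (simp_all add: enc_wt_def wt_def wt_node_cost_def comp_def)
qed

text \<open>The exact width ensures that the root has a top bit to read.\<close>

lemma length_weight_d_DNNF: "struct_d_DNNF f \<Longrightarrow> 0 < n \<Longrightarrow> length (fst (weight n pol f)) = Suc n"
proof (induction f)
  case (And fs)
  then show ?case by (cases fs) (simp_all add: one_bits_def)
next
  case (Or fs)
  then show ?case by (cases fs) (simp_all add: zero_bits_def)
qed (auto simp: length_lit_bits)

definition entails_cost :: "nat \<Rightarrow> nat" where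
  "entails_cost M = clash_cost M + Suc M * (wt_node_cost M + 10 * M + 40) + 20 * M + 50"

text \<open>\<open>M\<close> exceeds the nodes of both DAGs together, hence every unary atom name,
  and leaves room for the extra bit of the weights.\<close>

lemma call_entails:
  fixes num :: "'a \<Rightarrow> nat"
  assumes \<psi>: "is_dag \<psi>" "struct_d_DNNF (dag_fm \<psi>)" and \<gamma>: "is_dag \<gamma>" "is_cube (dag_fm \<gamma>)"
    and num: "is_numbering num (atoms (dag_fm \<psi>) \<union> atoms (dag_fm \<gamma>))"
    and M: "length \<psi> + length \<gamma> < M"
  shows "call (prog e) 1 [enc_dag num \<psi>, enc_dag num \<gamma>] (enc_bool (prop_entails (dag_fm \<gamma>) (dag_fm \<psi>))) (entails_cost M)"
proof -
  let ?pol = "\<lambda>a. polarity num (num a) (dag_fm \<gamma>)"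
  let ?wt = "weight (length \<psi>) ?pol"
  define clash where "clash \<longleftrightarrow> (\<exists>a. NAtom a \<in> set \<gamma> \<and> fst (?pol a) \<and> snd (?pol a))"
  have ne: "\<psi> \<noteq> []" using \<psi>(1) by (simp add: is_dag_def)
  have "card (atoms (dag_fm \<psi>) \<union> atoms (dag_fm \<gamma>)) \<le> length \<psi> + length \<gamma>"
    using card_Un_le[of "atoms (dag_fm \<psi>)" "atoms (dag_fm \<gamma>)"] card_atoms_dag_fm(2)[OF \<psi>(1)]
      card_atoms_dag_fm(2)[OF \<gamma>(1)] by linarith
  then have small: "num a < M" if "a \<in> atoms (dag_fm \<psi>) \<union> atoms (dag_fm \<gamma>)" for a
    using bij_betwE[OF num[unfolded is_numbering_def]] that M by (meson lessThan_iff less_le_trans order.strict_trans)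
  have inj: "inj_on num (atoms (dag_fm \<psi>) \<union> atoms (dag_fm \<gamma>))"
    using num by (simp add: is_numbering_def bij_betw_def)
  have iff: "prop_entails (dag_fm \<gamma>) (dag_fm \<psi>) \<longleftrightarrow> clash \<or> last (fst (?wt (dag_fm \<psi>)))"
    using prop_entails_iff_weight[OF \<psi>(2) card_atoms_dag_fm[OF \<psi>(1)] _ \<gamma>(2) inj] ne
    by (simp add: clash_def atoms_dag_fm[OF \<gamma>(1)])
  have C: "call (prog e) 15 [enc_dag num \<gamma>, enc_dag num \<gamma>] (enc_bool clash) (clash_cost M)"
    unfolding clash_def
    by (rule call_weaken[OF call_clash_aux[OF \<gamma>(1), where M = M] refl])
      (use M small \<gamma>(1) in \<open>auto simp: clash_cost_def atoms_dag_fm intro!: mult_le_mono1\<close>)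
  show ?thesis
  proof (cases clash)
    case True
    note C' = C[unfolded enc_bool_def, simplified True if_True]
    show ?thesis unfolding call_prog entails_body_def
      by (rule runs_weaken, (rule C' runs_intros)+) (simp_all add: iff True entails_cost_def)
  next
    case False
    note C' = C[unfolded enc_bool_def, simplified False if_False]
    have us: "enc_dag num \<psi> = enc_list (map (enc_node num) \<psi>)" by (simp add: enc_dag_def)
    have T: "call (prog e) 20 [enc_dag num \<psi>, Lf, enc_dag num \<psi>, enc_dag num \<gamma>]
        (enc_list (map (\<lambda>f. enc_wt (?wt f)) (dag_fms \<psi>))) (Suc M * (wt_node_cost M + 10 * M + 40))"
    proof (rule call_table[where h = 19])
      fix x :: "'a node" and fs :: "'a fm list"
      assume x: "x \<in> set \<psi>" "\<forall>c\<in>set (children x). c < length fs" "length fs \<le> M"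
      have "length (children x) \<le> M"
        using length_children_le[OF \<psi>(1) x(1)] M by linarith
      moreover have "num a < M" if "x = NAtom a" for a
        using small that x(1) atoms_dag_fm[OF \<psi>(1)] by blast
      ultimately have "call (prog e) 19 [enc_node num x,
          enc_list (map (\<lambda>f. enc_wt (weight (length (map (enc_node num) \<psi>)) ?pol f)) fs),
          enc_list (map (enc_node num) \<psi>), enc_dag num \<gamma>]
        (enc_wt (weight (length (map (enc_node num) \<psi>)) ?pol (node_fm fs x))) (wt_node_cost M)"
        using x \<gamma>(1) M ne by (intro call_wt_node) simp_all
      then show "call (prog e) 19 [enc_node num x, enc_list (map (\<lambda>f. enc_wt (?wt f)) fs), enc_dag num \<psi>, enc_dag num \<gamma>]
        (enc_wt (?wt (node_fm fs x))) (wt_node_cost M)"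
        by (simp add: us)
    qed (use \<psi>(1) M in simp_all)
    have L: "call (prog e) 2 [enc_list (map (\<lambda>f. enc_wt (?wt f)) (dag_fms \<psi>))] (enc_wt (?wt (dag_fm \<psi>))) (10 * M)"
      using call_last_dag[OF \<psi>(1), where r = "\<lambda>f. enc_wt (?wt f)"] M by simp
    have len: "length (fst (?wt (dag_fm \<psi>))) = Suc (length \<psi>)"
      using length_weight_d_DNNF[OF \<psi>(2)] ne by simp
    have ne': "fst (?wt (dag_fm \<psi>)) \<noteq> []" using len by auto
    have "length \<gamma> > 0" using \<gamma>(1) by (simp add: is_dag_def)
    then have L': "call (prog e) 2 [enc_bits (fst (?wt (dag_fm \<psi>)))] (enc_bool (last (fst (?wt (dag_fm \<psi>))))) (10 * M)"
      unfolding enc_bits_def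
      by (intro call_weaken[OF call_last]) (use len M ne' in \<open>auto simp: last_map\<close>)
    show ?thesis unfolding call_prog entails_body_def
      by (rule runs_weaken, (rule C' T L L' enc_wt_proj runs_intros)+)
        (simp_all add: iff False entails_cost_def)
  qed
qed

lemma decides_within_prog:
  assumes "runs (prog e) us e (enc_bool b) n"
  shows "decides_within (prog e) us b n"
proof -
  have "prog e \<noteq> []" "hd (prog e) = e" "enc_bool b \<noteq> Lf \<longleftrightarrow> b"
    by (simp_all add: prog_def enc_bool_def)
  then show ?thesis using assms unfolding decides_within_def runs_def by metis
qed

section \<open>Polynomial bounds\<close>

lemma poly_const_fun: "\<exists>q::nat poly. \<forall>x. c = poly q x"
  by (rule exI[of _ "[:c:]"]) simp

lemma poly_id_fun: "\<exists>q::nat poly. \<forall>x. x = poly q x"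
  by (rule exI[of _ "[:0, 1:]"]) simp

lemma poly_Suc_fun: "\<exists>q::nat poly. \<forall>x. f x = poly q x \<Longrightarrow> \<exists>q::nat poly. \<forall>x. Suc (f x) = poly q x"
  by (metis add.commute plus_1_eq_Suc poly_1 poly_add)

lemma poly_add_fun:
  "\<exists>q::nat poly. \<forall>x. f x = poly q x \<Longrightarrow> \<exists>q::nat poly. \<forall>x. g x = poly q x \<Longrightarrow> \<exists>q::nat poly. \<forall>x. f x + g x = poly q x"
  by (metis poly_add)

lemma poly_mult_fun:
  "\<exists>q::nat poly. \<forall>x. f x = poly q x \<Longrightarrow> \<exists>q::nat poly. \<forall>x. g x = poly q x \<Longrightarrow> \<exists>q::nat poly. \<forall>x. f x * g x = poly q x"
  by (metis poly_mult)

text \<open>The costs are built from constants and \<open>M\<close> by sums and products, so no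
  degree need be computed. \<open>c\<close> raises the input size to \<open>M\<close>,
  \<open>d\<close> pays for the entry expression.\<close>

lemma entails_cost_poly: "\<exists>q::nat poly. \<forall>x. entails_cost (x + c) + d = poly q x"
  unfolding entails_cost_def wt_node_cost_def prod_cost_def sum_cost_def clash_cost_def pol_cost_def
    pol_node_cost_def any_cost_def
  by (intro poly_add_fun poly_mult_fun poly_Suc_fun poly_const_fun poly_id_fun)

theorem theorem5p4:
  fixes \<Sigma> :: "('p, 'f, 'v, 's) signature"
    and T :: "('p, 'f, 's, 'u) struct set"
  assumes "is_theory \<Sigma> T"
  shows
    "(\<exists>P q. \<forall>(\<psi> :: ('p, 'f, 'v, 'b) atom dag) \<alpha> num.
       is_dag \<psi> \<and> d_DNNF (abstraction (dag_fm \<psi>)) \<and>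
       finite \<alpha> \<and> (\<forall>a\<in>\<alpha>. well_sorted \<Sigma> a) \<and> atoms (dag_fm \<psi>) \<subseteq> \<alpha> \<and>
       T_extended \<Sigma> T \<alpha> (dag_fm \<psi>) \<and>
       is_numbering num (atoms (dag_fm \<psi>)) \<longrightarrow>
       decides_within P [enc_dag num \<psi>] (T_valid \<Sigma> T (dag_fm \<psi>)) (poly q (dag_size \<psi>))) \<and>
     (\<exists>P q. \<forall>(\<psi> :: ('p, 'f, 'v, 'b) atom dag) \<alpha> \<gamma> num.
       is_dag \<psi> \<and> d_DNNF (abstraction (dag_fm \<psi>)) \<and>
       finite \<alpha> \<and> (\<forall>a\<in>\<alpha>. well_sorted \<Sigma> a) \<and> atoms (dag_fm \<psi>) \<subseteq> \<alpha> \<and>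
       T_extended \<Sigma> T \<alpha> (dag_fm \<psi>) \<and>
       is_dag \<gamma> \<and> is_cube (dag_fm \<gamma>) \<and> atoms (dag_fm \<gamma>) \<subseteq> \<alpha> \<and>
       is_numbering num (atoms (dag_fm \<psi>) \<union> atoms (dag_fm \<gamma>)) \<longrightarrow>
       decides_within P [enc_dag num \<psi>, enc_dag num \<gamma>]
         (T_entails \<Sigma> T (dag_fm \<gamma>) (dag_fm \<psi>)) (poly q (dag_size \<psi> + dag_size \<gamma>)))"
proof
  let ?top = "[NAnd []] :: ('p, 'f, 'v, 'b) atom dag"
  \<comment> \<open>The second argument builds the code of \<open>?top\<close>: a one-node list with
    tag 2 and no children, the same for every \<open>num\<close>.\<close>
  define e where "e = ECall 1 [Arg 0, EBr (EBr (EBr ELf ETrue) ELf) ELf]"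
  \<comment> \<open>One for the node of \<open>?top\<close>, one for the strict bound on
    \<open>M\<close>; 20 covers building the constant and the call.\<close>
  obtain q :: "nat poly" where q: "\<And>x. entails_cost (x + 2) + 20 = poly q x"
    using entails_cost_poly by metis
  have "decides_within (prog e) [enc_dag num \<psi>] (T_valid \<Sigma> T (dag_fm \<psi>)) (poly q (dag_size \<psi>))"
    if \<psi>: "is_dag \<psi>" "d_DNNF (abstraction (dag_fm \<psi>))"
      and \<alpha>: "finite \<alpha>" "atoms (dag_fm \<psi>) \<subseteq> \<alpha>" "T_extended \<Sigma> T \<alpha> (dag_fm \<psi>)"
      and num: "is_numbering num (atoms (dag_fm \<psi>))"
    for \<psi> :: "('p, 'f, 'v, 'b) atom dag" and \<alpha> num
  proof -
    have top: "dag_fm ?top = And []" by (simp add: dag_fm_def dag_fms_def)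
    have enc: "enc_dag num ?top = Br (Br (Br Lf (Br Lf Lf)) Lf) Lf"
      by (simp add: enc_dag_def numeral_eq_Suc)
    have "is_dag ?top" "is_cube (dag_fm ?top)" by (simp_all add: is_dag_def is_cube_def top)
    then have "call (prog e) 1 [enc_dag num \<psi>, enc_dag num ?top]
        (enc_bool (prop_entails (dag_fm ?top) (dag_fm \<psi>))) (entails_cost (length \<psi> + 2))"
      using num \<psi> by (intro call_entails struct_d_DNNF_if_abstraction) (simp_all add: top abstraction_def)
    note C = this[unfolded enc]
    have "runs (prog e) [enc_dag num \<psi>] e (enc_bool (prop_entails (dag_fm ?top) (dag_fm \<psi>))) (entails_cost (length \<psi> + 2) + 20)"
      unfolding e_def by (rule runs_weaken, (rule C[unfolded e_def] runs_intros)+) simp_all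
    moreover have "prop_entails (dag_fm ?top) (dag_fm \<psi>) \<longleftrightarrow> T_valid \<Sigma> T (dag_fm \<psi>)"
      using T_entails_iff_prop_entails[OF \<alpha>(1,2) _ \<alpha>(3), of "And []"]
      by (simp add: top T_entails_def T_valid_def)
    ultimately show ?thesis
      unfolding dag_size_def by (intro decides_within_prog) (simp only: q)
  qed
  then show "\<exists>P q. \<forall>(\<psi> :: ('p, 'f, 'v, 'b) atom dag) \<alpha> num.
       is_dag \<psi> \<and> d_DNNF (abstraction (dag_fm \<psi>)) \<and>
       finite \<alpha> \<and> (\<forall>a\<in>\<alpha>. well_sorted \<Sigma> a) \<and> atoms (dag_fm \<psi>) \<subseteq> \<alpha> \<and>
       T_extended \<Sigma> T \<alpha> (dag_fm \<psi>) \<and>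
       is_numbering num (atoms (dag_fm \<psi>)) \<longrightarrow>
       decides_within P [enc_dag num \<psi>] (T_valid \<Sigma> T (dag_fm \<psi>)) (poly q (dag_size \<psi>))"
    by (intro exI[of _ "prog e"] exI[of _ q]) blast
next
  define e where "e = ECall 1 [Arg 0, Arg 1]"
  \<comment> \<open>Here both DAGs are counted already, so only the strict bound on \<open>M\<close>
    adds 1.\<close>
  obtain q :: "nat poly" where q: "\<And>x. entails_cost (x + 1) + 20 = poly q x"
    using entails_cost_poly by metis
  have "decides_within (prog e) [enc_dag num \<psi>, enc_dag num \<gamma>] (T_entails \<Sigma> T (dag_fm \<gamma>) (dag_fm \<psi>))
      (poly q (dag_size \<psi> + dag_size \<gamma>))"
    if \<psi>: "is_dag \<psi>" "d_DNNF (abstraction (dag_fm \<psi>))"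
      and \<alpha>: "finite \<alpha>" "atoms (dag_fm \<psi>) \<subseteq> \<alpha>" "T_extended \<Sigma> T \<alpha> (dag_fm \<psi>)"
      and \<gamma>: "is_dag \<gamma>" "is_cube (dag_fm \<gamma>)" "atoms (dag_fm \<gamma>) \<subseteq> \<alpha>"
      and num: "is_numbering num (atoms (dag_fm \<psi>) \<union> atoms (dag_fm \<gamma>))"
    for \<psi> \<gamma> :: "('p, 'f, 'v, 'b) atom dag" and \<alpha> num
  proof -
    have C: "call (prog e) 1 [enc_dag num \<psi>, enc_dag num \<gamma>]
        (enc_bool (prop_entails (dag_fm \<gamma>) (dag_fm \<psi>))) (entails_cost (length \<psi> + length \<gamma> + 1))"
      using num \<psi> \<gamma> by (intro call_entails struct_d_DNNF_if_abstraction) (simp_all add: abstraction_def)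
    have "runs (prog e) [enc_dag num \<psi>, enc_dag num \<gamma>] e (enc_bool (prop_entails (dag_fm \<gamma>) (dag_fm \<psi>)))
        (entails_cost (length \<psi> + length \<gamma> + 1) + 20)"
      unfolding e_def by (rule runs_weaken, (rule C[unfolded e_def] runs_intros)+) simp_all
    then show ?thesis
      using T_entails_iff_prop_entails[OF \<alpha>(1,2) \<gamma>(3) \<alpha>(3)]
      unfolding dag_size_def by (intro decides_within_prog) (simp only: q)
  qed
  then show "\<exists>P q. \<forall>(\<psi> :: ('p, 'f, 'v, 'b) atom dag) \<alpha> \<gamma> num.
       is_dag \<psi> \<and> d_DNNF (abstraction (dag_fm \<psi>)) \<and>
       finite \<alpha> \<and> (\<forall>a\<in>\<alpha>. well_sorted \<Sigma> a) \<and> atoms (dag_fm \<psi>) \<subseteq> \<alpha> \<and>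
       T_extended \<Sigma> T \<alpha> (dag_fm \<psi>) \<and>
       is_dag \<gamma> \<and> is_cube (dag_fm \<gamma>) \<and> atoms (dag_fm \<gamma>) \<subseteq> \<alpha> \<and>
       is_numbering num (atoms (dag_fm \<psi>) \<union> atoms (dag_fm \<gamma>)) \<longrightarrow>
       decides_within P [enc_dag num \<psi>, enc_dag num \<gamma>]
         (T_entails \<Sigma> T (dag_fm \<gamma>) (dag_fm \<psi>)) (poly q (dag_size \<psi> + dag_size \<gamma>))"
    by (intro exI[of _ "prog e"] exI[of _ q]) blast
qed

end
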